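(* Let $\mathcal H\subset\mathcal H'$ be Hilbert spaces of dimensions $d$ and $d+1$ respectively, let $|\omega\rangle\in\mathcal H'$ be a unit vector orthogonal to $\mathcal H$, let $0\le\epsilon\le1$, and let $\Phi:\mathfrak S(\mathcal H)\to\mathfrak S(\mathcal H')$ be the erasure channel $\Phi(\sigma)=\epsilon|\omega\rangle\langle\omega|+(1-\epsilon)\sigma$. Let $\mathcal K$ be a finite-dimensional Hilbert space. Then for every quantum channel $\Omega:\mathfrak S(\mathcal K)\to\mathfrak S(\mathcal K)$ and every $\rho\in\mathfrak S(\mathcal H\otimes\mathcal K)$, $$H_{\Phi\otimes\Omega}(\rho)\ge H_\Phi(\mathrm{Tr}_{\mathcal K}(\rho))+H_\Omega(\mathrm{Tr}_{\mathcal H}(\rho)).$$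
   Context: $\mathfrak S(\cdot)$ denotes the set of density operators (and $\mathfrak S(\mathcal H)\subset\mathfrak S(\mathcal H')$ via the inclusion $\mathcal H\subset\mathcal H'$); a quantum channel is a completely positive trace-preserving linear map; $S(\sigma)=-\mathrm{Tr}(\sigma\log\sigma)$ is the von Neumann entropy. For a channel $\Psi$ with input space $\mathcal L$ and $\sigma\in\mathfrak S(\mathcal L)$, $H_\Psi(\sigma):=\min\sum_{j}\pi_jS(\Psi(\sigma_j))$, the minimum over all finite decompositions $\sigma=\sum_j\pi_j\sigma_j$ with $\{\pi_j\}$ a probability distribution and $\sigma_j\in\mathfrak S(\mathcal L)$. *)

theory Defs
  imports "Jordan_Normal_Form.Char_Poly" "HOL-Computational_Algebra.Polynomial"
begin

(* Finite-dimensional Hilbert spaces are C^n; operators are complex n x n matrices.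
   Composite index convention for C^n \<otimes> C^m: (x, a) \<mapsto> x * m + a. *)

definition mtrace :: "complex mat \<Rightarrow> complex" where
  "mtrace A = (\<Sum>i<dim_row A. A $$ (i, i))"

definition psd :: "nat \<Rightarrow> complex mat \<Rightarrow> bool" where
  "psd n A \<longleftrightarrow> A \<in> carrier_mat n n \<and>
     (\<forall>i<n. \<forall>j<n. A $$ (i, j) = cnj (A $$ (j, i))) \<and>
     (\<forall>v \<in> carrier_vec n.
        Im (\<Sum>i<n. \<Sum>j<n. cnj (v $ i) * A $$ (i, j) * v $ j) = 0 \<and>
        Re (\<Sum>i<n. \<Sum>j<n. cnj (v $ i) * A $$ (i, j) * v $ j) \<ge> 0)"

definition density :: "nat \<Rightarrow> complex mat \<Rightarrow> bool" where
  "density n A \<longleftrightarrow> psd n A \<and> mtrace A = 1"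

definition id_tensor :: "nat \<Rightarrow> nat \<Rightarrow> nat \<Rightarrow> (complex mat \<Rightarrow> complex mat) \<Rightarrow> complex mat \<Rightarrow> complex mat" where
  "id_tensor p n m \<Psi> X = mat (p * m) (p * m) (\<lambda>(r, s).
      \<Psi> (mat n n (\<lambda>(a, b). X $$ ((r div m) * n + a, (s div m) * n + b))) $$ (r mod m, s mod m))"

definition channel :: "nat \<Rightarrow> nat \<Rightarrow> (complex mat \<Rightarrow> complex mat) \<Rightarrow> bool" where
  "channel n m \<Psi> \<longleftrightarrow>
     (\<forall>A \<in> carrier_mat n n. \<Psi> A \<in> carrier_mat m m) \<and>
     (\<forall>A \<in> carrier_mat n n. \<forall>B \<in> carrier_mat n n. \<Psi> (A + B) = \<Psi> A + \<Psi> B) \<and>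
     (\<forall>A \<in> carrier_mat n n. \<forall>c. \<Psi> (c \<cdot>\<^sub>m A) = c \<cdot>\<^sub>m \<Psi> A) \<and>
     (\<forall>A \<in> carrier_mat n n. mtrace (\<Psi> A) = mtrace A) \<and>
     (\<forall>p X. psd (p * n) X \<longrightarrow> psd (p * m) (id_tensor p n m \<Psi> X))"

definition mat_unit :: "nat \<Rightarrow> nat \<Rightarrow> nat \<Rightarrow> complex mat" where
  "mat_unit n i j = mat n n (\<lambda>(x, y). if x = i \<and> y = j then 1 else 0)"

text \<open>Tensor product \<Phi> \<otimes> \<Omega> of maps (\<Phi> : d x d \<rightarrow> d' x d', \<Omega> : k x k \<rightarrow> k' x k'), defined by linearity.\<close>
definition chan_tensor :: "nat \<Rightarrow> nat \<Rightarrow> nat \<Rightarrow> nat \<Rightarrow> (complex mat \<Rightarrow> complex mat) \<Rightarrow>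
    (complex mat \<Rightarrow> complex mat) \<Rightarrow> complex mat \<Rightarrow> complex mat" where
  "chan_tensor d d' k k' \<Phi> \<Omega> X = mat (d' * k') (d' * k') (\<lambda>(r, s).
      \<Sum>i<d. \<Sum>j<d. \<Sum>a<k. \<Sum>b<k. X $$ (i * k + a, j * k + b) *
        \<Phi> (mat_unit d i j) $$ (r div k', s div k') * \<Omega> (mat_unit k a b) $$ (r mod k', s mod k'))"

definition ptrace_K :: "nat \<Rightarrow> nat \<Rightarrow> complex mat \<Rightarrow> complex mat" where
  "ptrace_K d k \<rho> = mat d d (\<lambda>(i, j). \<Sum>a<k. \<rho> $$ (i * k + a, j * k + a))"

definition ptrace_H :: "nat \<Rightarrow> nat \<Rightarrow> complex mat \<Rightarrow> complex mat" where
  "ptrace_H d k \<rho> = mat k k (\<lambda>(a, b). \<Sum>i<d. \<rho> $$ (i * k + a, i * k + b))"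

text \<open>von Neumann entropy via the eigenvalues (with algebraic multiplicity), 0 log 0 = 0.\<close>
definition eta :: "real \<Rightarrow> real" where
  "eta x = (if x \<le> 0 then 0 else x * ln x)"

definition vn_entropy :: "complex mat \<Rightarrow> real" where
  "vn_entropy A = - (\<Sum>z \<in># proots (char_poly A). eta (Re z))"

text \<open>H_\<Psi>(\<sigma>): minimum (infimum, attained) of average output entropy over finite
  convex decompositions of \<sigma> into density operators on C^n.\<close>
definition H_chan :: "nat \<Rightarrow> (complex mat \<Rightarrow> complex mat) \<Rightarrow> complex mat \<Rightarrow> real" where
  "H_chan n \<Psi> \<sigma> = Inf {(\<Sum>j<N. \<pi> j * vn_entropy (\<Psi> (\<sigma>s j))) | (N::nat) \<pi> \<sigma>s.
      (\<forall>j<N. 0 \<le> \<pi> j \<and> density n (\<sigma>s j)) \<and> (\<Sum>j<N. \<pi> j) = 1 \<and>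
      (\<forall>a<n. \<forall>b<n. \<sigma> $$ (a, b) = (\<Sum>j<N. complex_of_real (\<pi> j) * \<sigma>s j $$ (a, b)))}"

text \<open>Erasure channel C^d \<rightarrow> C^(d+1) (C^d embedded as the first d coordinates), linearly extended:
  \<Phi>(\<sigma>) = \<epsilon> Tr(\<sigma>) |\<omega>><\<omega>| + (1 - \<epsilon>) \<sigma>.\<close>
definition erasure :: "nat \<Rightarrow> real \<Rightarrow> complex vec \<Rightarrow> complex mat \<Rightarrow> complex mat" where
  "erasure d \<epsilon> \<omega> \<sigma> = mat (Suc d) (Suc d) (\<lambda>(i, j).
      complex_of_real \<epsilon> * mtrace \<sigma> * \<omega> $ i * cnj (\<omega> $ j) +
      complex_of_real (1 - \<epsilon>) * (if i < d \<and> j < d then \<sigma> $$ (i, j) else 0))"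

end

theory Submission
  imports Defs "Jordan_Normal_Form.Schur_Decomposition"
begin

text \<open>Write \<open>h\<close> for the binary entropy of \<open>\<epsilon>\<close>. Pure inputs of the erasure channel have output
  entropy \<open>h\<close>, so \<open>H_\<Phi> \<le> h\<close>. The output of \<open>\<Phi> \<otimes> \<Omega>\<close> on \<open>\<sigma>\<close> is block diagonal, so its entropy is
  \<open>h + \<epsilon> S(\<Omega>(Tr_H \<sigma>)) + (1 - \<epsilon>) S((id \<otimes> \<Omega>)(\<sigma>))\<close>. Both entropies in this sum are at least
  \<open>H_\<Omega>(Tr_H \<sigma>)\<close>, and the theorem follows because \<open>H_\<Omega>\<close> is convex.

  Only the bound for \<open>B = (id \<otimes> \<Omega>)(\<sigma>)\<close> needs work. The normalised diagonal blocks \<open>\<tau>_i\<close> of \<open>\<sigma>\<close>, with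
  weights \<open>q_i\<close>, decompose \<open>Tr_H \<sigma>\<close>, and \<open>B\<close> is positive with diagonal blocks \<open>q_i \<Omega>(\<tau>_i)\<close>. Factor
  \<open>B = W W*\<close> and cut \<open>W\<close> into block rows \<open>W_i\<close>, so that \<open>W_i W_i* = q_i \<Omega>(\<tau>_i)\<close>. Then \<open>B\<close> has the
  nonzero spectrum of \<open>W* W\<close>, which is the sum of the \<open>W_i* W_i\<close>, and these have the nonzero spectra
  of the \<open>q_i \<Omega>(\<tau>_i)\<close>; concavity of the entropy gives the bound. Neither Kraus operators nor
  purifications are needed.\<close>

section \<open>Adjoint and unitary matrices\<close>

lemma mat_adjoint_carrier [simp]: "A \<in> carrier_mat n m \<Longrightarrow> mat_adjoint A \<in> carrier_mat m n"
  by (intro carrier_matI) (auto simp: mat_adjoint_def)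

lemma dim_mat_adjoint [simp]:
  "dim_row (mat_adjoint A) = dim_col A" "dim_col (mat_adjoint A) = dim_row A"
  by (simp_all add: mat_adjoint_def)

lemma index_mat_adjoint [simp]:
  "i < dim_col A \<Longrightarrow> j < dim_row A \<Longrightarrow> mat_adjoint A $$ (i, j) = conjugate (A $$ (j, i))"
  by (simp add: mat_adjoint_def mat_of_rows_index)

lemma mat_adjoint_mat_adjoint [simp]: "mat_adjoint (mat_adjoint A) = A"
  by (rule eq_matI) auto

lemma mat_adjoint_eq_self_iff:
  assumes "A \<in> carrier_mat n n"
  shows "mat_adjoint A = A \<longleftrightarrow> (\<forall>i<n. \<forall>j<n. conjugate (A $$ (j, i)) = A $$ (i, j))"
proof
  assume "mat_adjoint A = A"
  then have "mat_adjoint A $$ (i, j) = A $$ (i, j)" for i j by simp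
  then show "\<forall>i<n. \<forall>j<n. conjugate (A $$ (j, i)) = A $$ (i, j)"
    using assms by (metis carrier_matD index_mat_adjoint)
qed (use assms in \<open>auto intro!: eq_matI\<close>)

lemma index_mult_mat_sum:
  assumes "A \<in> carrier_mat n m" "B \<in> carrier_mat m p" "i < n" "j < p"
  shows "(A * B) $$ (i, j) = (\<Sum>x<m. A $$ (i, x) * B $$ (x, j))"
  using assms by (auto simp: scalar_prod_def atLeast0LessThan)

lemma mat_adjoint_mult:
  fixes A B :: "'a :: conjugatable_field mat"
  assumes "A \<in> carrier_mat n m" "B \<in> carrier_mat m p"
  shows "mat_adjoint (A * B) = mat_adjoint B * mat_adjoint A"
  by (rule eq_matI)
    (use assms in \<open>auto simp: scalar_prod_def sum_conjugate conjugate_dist_mul mult.commute\<close>)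

lemma mat_adjoint_mat_diag [simp]: "mat_adjoint (mat_diag n f) = mat_diag n (\<lambda>i. conjugate (f i))"
  for f :: "nat \<Rightarrow> 'a :: conjugatable_field"
  by (rule eq_matI) (auto simp: mat_diag_def)

lemma index_adjoint_mult_self:
  fixes A :: "'a :: conjugatable_field mat"
  assumes "A \<in> carrier_mat n m" "i < m" "j < m"
  shows "(mat_adjoint A * A) $$ (i, j) = col A j \<bullet>c col A i"
  using assms by (auto simp: scalar_prod_def mult.commute)

lemma mult_mat_vec_cscalar_prod:
  fixes A :: "'a :: conjugatable_field mat"
  assumes "A \<in> carrier_mat n m" "v \<in> carrier_vec m" "w \<in> carrier_vec n"
  shows "(A *\<^sub>v v) \<bullet>c w = v \<bullet>c (mat_adjoint A *\<^sub>v w)"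
proof -
  have "(A *\<^sub>v v) \<bullet>c w = (\<Sum>i<n. \<Sum>j<m. A $$ (i, j) * v $ j * conjugate (w $ i))"
    using assms by (auto simp: scalar_prod_def atLeast0LessThan sum_distrib_right)
  also have "\<dots> = (\<Sum>j<m. \<Sum>i<n. A $$ (i, j) * v $ j * conjugate (w $ i))"
    by (rule sum.swap)
  also have "\<dots> = v \<bullet>c (mat_adjoint A *\<^sub>v w)"
    using assms
    by (auto simp: scalar_prod_def atLeast0LessThan sum_conjugate conjugate_dist_mul
        sum_distrib_left mult_ac)
  finally show ?thesis .
qed

definition unitary :: "nat \<Rightarrow> 'a :: conjugatable_field mat \<Rightarrow> bool" where
  "unitary n U \<longleftrightarrow> U \<in> carrier_mat n n \<and> mat_adjoint U * U = 1\<^sub>m n"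

lemma unitaryD:
  assumes "unitary n U"
  shows "U \<in> carrier_mat n n" "mat_adjoint U * U = 1\<^sub>m n" "U * mat_adjoint U = 1\<^sub>m n"
  using assms mat_mult_left_right_inverse[of "mat_adjoint U" n U] by (auto simp: unitary_def)

lemma unitary_mat_adjoint: "unitary n U \<Longrightarrow> unitary n (mat_adjoint U)"
  by (simp add: unitary_def[of n "mat_adjoint U"] unitaryD)

abbreviation unitary_diag :: "nat \<Rightarrow> complex mat \<Rightarrow> (nat \<Rightarrow> real) \<Rightarrow> complex mat" where
  "unitary_diag n U l \<equiv> U * mat_diag n (\<lambda>i. of_real (l i)) * mat_adjoint U"

lemma unitary_adjoint_mult_cancel:
  assumes "unitary n U" "A \<in> carrier_mat n m"
  shows "mat_adjoint U * (U * A) = A"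
  using unitaryD[OF assms(1)] assms(2)
  by (simp flip: assoc_mult_mat[of _ n n _ n _ m] add: left_mult_one_mat[of _ n m])

lemma unitary_conj_cancel:
  assumes "unitary n U" "A \<in> carrier_mat n n"
  shows "mat_adjoint U * (U * A * mat_adjoint U) * U = A"
proof -
  note [simp] = unitaryD[OF assms(1)] assms(2) mult_carrier_mat[of _ n n _ n]
  have "mat_adjoint U * (U * A * mat_adjoint U) * U = mat_adjoint U * (U * (A * (mat_adjoint U * U)))"
    by (simp add: assoc_mult_mat[of _ n n _ n _ n] del: unitaryD(2)[OF assms(1)])
  then show ?thesis
    by (simp add: unitary_adjoint_mult_cancel[OF assms] right_mult_one_mat[OF assms(2)])
qed

lemma unitary_mult:
  assumes U: "unitary n U" and V: "unitary n V"
  shows "unitary n (U * V)"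
proof -
  note [simp] = unitaryD[OF U] unitaryD[OF V] mult_carrier_mat[of _ n n _ n]
  have "mat_adjoint (U * V) * (U * V) = mat_adjoint V * (mat_adjoint U * U) * V"
    by (simp add: mat_adjoint_mult[of _ n n _ n] assoc_mult_mat[of _ n n _ n _ n] del: unitaryD(2)[OF U])
  then show ?thesis
    by (simp add: unitary_def right_mult_one_mat[of _ n n])
qed

lemma mat_adjoint_four_block_diag:
  fixes A D :: "'a :: conjugatable_field mat"
  assumes "A \<in> carrier_mat n n" "D \<in> carrier_mat m m"
  shows "mat_adjoint (four_block_mat A (0\<^sub>m n m) (0\<^sub>m m n) D) =
    four_block_mat (mat_adjoint A) (0\<^sub>m n m) (0\<^sub>m m n) (mat_adjoint D)"
  by (rule eq_matI) (use assms in auto)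

lemma mult_four_block_diag:
  fixes A B :: "'a :: comm_ring_1 mat"
  assumes "A \<in> carrier_mat n n" "B \<in> carrier_mat n n" "C \<in> carrier_mat m m" "D \<in> carrier_mat m m"
  shows "four_block_mat A (0\<^sub>m n m) (0\<^sub>m m n) C * four_block_mat B (0\<^sub>m n m) (0\<^sub>m m n) D =
    four_block_mat (A * B) (0\<^sub>m n m) (0\<^sub>m m n) (C * D)"
  using assms by (subst mult_four_block_mat[of _ n n _ m _ m]) auto

lemma unitary_four_block_diag:
  assumes "unitary n U" "unitary m V"
  shows "unitary (n + m) (four_block_mat U (0\<^sub>m n m) (0\<^sub>m m n) V)"
  using unitaryD[OF assms(1)] unitaryD[OF assms(2)]
  by (simp add: unitary_def mat_adjoint_four_block_diag mult_four_block_diag)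

lemma corthogonal_mat_gram:
  fixes P :: "complex mat"
  assumes P: "P \<in> carrier_mat n n" and orth: "corthogonal_mat P"
  obtains N :: "nat \<Rightarrow> real"
  where "\<And>i. i < n \<Longrightarrow> 0 < N i" "mat_adjoint P * P = mat_diag n (\<lambda>i. of_real (N i))"
proof
  define N where "N i = Re (col P i \<bullet>c col P i)" for i
  have gram_diag: "col P i \<bullet>c col P i = of_real (N i)" and N_pos: "0 < N i" if "i < n" for i
  proof -
    have "col P i \<bullet>c col P i \<noteq> 0" "0 \<le> col P i \<bullet>c col P i"
      using corthogonal_matD[OF orth, of i i] P that by auto
    then show "0 < N i" "col P i \<bullet>c col P i = of_real (N i)"
      by (auto simp: N_def less_eq_complex_def complex_eq_iff less_le)
  qed
  show "0 < N i" if "i < n" for i using N_pos that .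
  show "mat_adjoint P * P = mat_diag n (\<lambda>i. of_real (N i))"
  proof (rule eq_matI)
    fix i j assume "i < dim_row (mat_diag n (\<lambda>i. complex_of_real (N i)))"
      "j < dim_col (mat_diag n (\<lambda>i. complex_of_real (N i)))"
    then have ij: "i < n" "j < n" by (auto simp: mat_diag_def)
    then have "(mat_adjoint P * P) $$ (i, j) = (if i = j then of_real (N i) else 0)"
      unfolding index_adjoint_mult_self[OF P ij]
      using gram_diag corthogonal_matD[OF orth, of j i] P by auto
    then show "(mat_adjoint P * P) $$ (i, j) = mat_diag n (\<lambda>i. of_real (N i)) $$ (i, j)"
      using ij by (simp add: mat_diag_def)
  qed (use P in \<open>auto simp: mat_diag_def\<close>)
qed

lemma unitary_normalize_columns:
  fixes P :: "complex mat"
  assumes P: "P \<in> carrier_mat n n" and orth: "corthogonal_mat P"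
  obtains c where "unitary n (P * mat_diag n c)"
proof -
  obtain N :: "nat \<Rightarrow> real" where N_pos: "\<And>i. i < n \<Longrightarrow> 0 < N i"
    and gram: "mat_adjoint P * P = mat_diag n (\<lambda>i. of_real (N i))"
    using corthogonal_mat_gram[OF assms] by blast
  define c where "c i = complex_of_real (1 / sqrt (N i))" for i
  have c_scale: "cnj (c i) * of_real (N i) * c i = 1" if "i < n" for i
    using N_pos[OF that] by (simp add: c_def flip: of_real_mult)
  have "mat_adjoint (P * mat_diag n c) * (P * mat_diag n c) =
      mat_diag n (\<lambda>i. cnj (c i)) * (mat_adjoint P * P) * mat_diag n c"
    using P by (simp add: mat_adjoint_mult[of _ n n _ n] assoc_mult_mat[of _ n n _ n _ n]
        mult_carrier_mat[of _ n n _ n])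
  also have "\<dots> = 1\<^sub>m n"
    unfolding gram mat_diag_diag by (rule eq_matI) (use c_scale in \<open>auto simp: mat_diag_def\<close>)
  finally show ?thesis using that P by (auto simp: unitary_def)
qed

lemma ex_unitary_first_column:
  fixes v :: "complex vec"
  assumes v: "v \<in> carrier_vec n" "v \<noteq> 0\<^sub>v n" and n: "0 < n"
  obtains U c where "unitary n U" "col U 0 = c \<cdot>\<^sub>v v"
proof -
  interpret cof_vec_space n "TYPE(complex)" .
  define ws where "ws = gram_schmidt n (basis_completion v)"
  note basis = basis_completion[OF v]
  obtain vs where vs: "basis_completion v = v # vs"
    using basis(6,7) n by (cases "basis_completion v") auto
  have ws: "set ws \<subseteq> carrier_vec n" "corthogonal ws" "length ws = n"
    using gram_schmidt_result[OF basis(2,4,5) refl] basis(6) by (simp_all add: ws_def)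
  have "hd ws = v" using v by (simp add: ws_def vs)
  then have ws0: "ws ! 0 = v" using ws(3) n hd_conv_nth[of ws] by fastforce
  define P where "P = mat_of_cols n ws"
  have P: "P \<in> carrier_mat n n" using ws(3) mat_of_cols_carrier(1)[of n ws] by (simp add: P_def)
  have P_col: "P $$ (i, 0) = v $ i" if "i < n" for i
    using that n ws(3) ws0 by (simp add: P_def mat_of_cols_index)
  obtain c where "unitary n (P * mat_diag n c)"
    using unitary_normalize_columns[OF P] orthogonal_mat_of_cols[OF ws] by (auto simp: P_def)
  moreover have "col (P * mat_diag n c) 0 = c 0 \<cdot>\<^sub>v v"
    by (rule eq_vecI) (use P P_col n v in \<open>auto simp: mat_diag_mult_right[OF P]\<close>)
  ultimately show ?thesis by (rule that)
qed

section \<open>Spectral theorem for Hermitian matrices\<close>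

lemma hermitian_eigen_first_column:
  fixes A :: "complex mat"
  assumes A: "A \<in> carrier_mat (Suc n) (Suc n)" and herm: "mat_adjoint A = A"
    and col: "col A 0 = e \<cdot>\<^sub>v unit_vec (Suc n) 0"
  obtains r B where "B \<in> carrier_mat n n" "mat_adjoint B = B"
    "A = four_block_mat (mat 1 1 (\<lambda>_. of_real r)) (0\<^sub>m 1 n) (0\<^sub>m n 1) B"
proof
  have herm': "cnj (A $$ (j, i)) = A $$ (i, j)" if "i < Suc n" "j < Suc n" for i j
    using herm that by (simp add: mat_adjoint_eq_self_iff[OF A])
  have col0: "A $$ (i, 0) = (if i = 0 then e else 0)" if "i < Suc n" for i
    using A that index_col[of i A 0] by (auto simp: col split: if_splits)
  have row0: "A $$ (0, j) = (if j = 0 then e else 0)" if "j < Suc n" for j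
    using herm'[of 0 j] herm'[of 0 0] col0 that by (auto split: if_splits)
  have e_real: "of_real (Re e) = e"
    using herm'[of 0 0] col0[of 0] by (simp add: complex_eq_iff)
  let ?B = "mat n n (\<lambda>(i, j). A $$ (Suc i, Suc j))"
  show "?B \<in> carrier_mat n n" by simp
  show "mat_adjoint ?B = ?B"
    by (rule eq_matI) (auto simp: herm')
  show "A = four_block_mat (mat 1 1 (\<lambda>_. of_real (Re e))) (0\<^sub>m 1 n) (0\<^sub>m n 1) ?B"
    by (rule eq_matI) (use A row0 col0 in \<open>auto simp: e_real\<close>)
qed

lemma hermitian_deflation:
  fixes A :: "complex mat"
  assumes A: "A \<in> carrier_mat (Suc n) (Suc n)" and herm: "mat_adjoint A = A"
  obtains U r B where "unitary (Suc n) U" "B \<in> carrier_mat n n" "mat_adjoint B = B"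
    "A = U * four_block_mat (mat 1 1 (\<lambda>_. of_real r)) (0\<^sub>m 1 n) (0\<^sub>m n 1) B * mat_adjoint U"
proof -
  let ?N = "Suc n"
  obtain as where as: "char_poly A = (\<Prod>a\<leftarrow>as. [:- a, 1:])" "length as = ?N"
    using char_poly_factorized[OF A] by auto
  then obtain e es where "as = e # es" by (cases as) auto
  then have "eigenvalue A e" using as eigenvalue_root_char_poly[OF A] by simp
  then obtain v where v: "v \<in> carrier_vec ?N" "v \<noteq> 0\<^sub>v ?N" "A *\<^sub>v v = e \<cdot>\<^sub>v v"
    using A unfolding eigenvalue_def eigenvector_def by auto
  obtain U c where U: "unitary ?N U" and col0: "col U 0 = c \<cdot>\<^sub>v v"
    using ex_unitary_first_column[OF v(1,2)] by auto
  note [simp] = mult_carrier_mat[of _ ?N ?N _ ?N] unitaryD[OF U] A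
  define A' where "A' = mat_adjoint U * A * U"
  have A_eq: "A = U * A' * mat_adjoint U"
    using unitary_conj_cancel[OF unitary_mat_adjoint[OF U] A] by (simp add: A'_def)
  have "col A' 0 = mat_adjoint U *\<^sub>v (A *\<^sub>v col U 0)"
    by (simp add: A'_def assoc_mult_mat[of _ ?N ?N _ ?N _ ?N] col_mult2[of _ ?N ?N _ ?N])
  also have "A *\<^sub>v col U 0 = e \<cdot>\<^sub>v col U 0"
    using v by (simp add: col0 mult_mat_vec[OF A] smult_smult_assoc mult.commute)
  also have "mat_adjoint U *\<^sub>v (e \<cdot>\<^sub>v col U 0) = e \<cdot>\<^sub>v col (mat_adjoint U * U) 0"
    using unitaryD(1)[OF U] col_carrier_vec[of 0 ?N U ?N]
    by (subst mult_mat_vec[of _ ?N ?N])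
      (simp_all add: col_mult2[of _ ?N ?N _ ?N] del: unitaryD(2)[OF U])
  finally have "col A' 0 = e \<cdot>\<^sub>v unit_vec ?N 0" by simp
  moreover have "A' \<in> carrier_mat ?N ?N" by (simp add: A'_def)
  moreover have "mat_adjoint A' = A'"
    by (simp add: A'_def mat_adjoint_mult[of _ ?N ?N _ ?N] herm assoc_mult_mat[of _ ?N ?N _ ?N _ ?N])
  ultimately obtain r B where "B \<in> carrier_mat n n" "mat_adjoint B = B"
    "A' = four_block_mat (mat 1 1 (\<lambda>_. of_real r)) (0\<^sub>m 1 n) (0\<^sub>m n 1) B"
    using hermitian_eigen_first_column by blast
  then show ?thesis using that U A_eq by blast
qed

theorem hermitian_unitary_diagonalization:
  fixes A :: "complex mat"
  assumes "A \<in> carrier_mat n n" "mat_adjoint A = A"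
  obtains U l where "unitary n U" "A = unitary_diag n U l"
proof -
  have "\<exists>U l. unitary n U \<and> A = unitary_diag n U l"
    using assms
  proof (induction n arbitrary: A)
    case 0
    then show ?case
      by (intro exI[of _ "1\<^sub>m 0"] exI) (auto simp: unitary_def intro!: eq_matI)
  next
    case (Suc n)
    let ?N = "Suc n"
    obtain U e B where U: "unitary ?N U" and B: "B \<in> carrier_mat n n" "mat_adjoint B = B"
      and A_eq: "A = U * four_block_mat (mat 1 1 (\<lambda>_. of_real e)) (0\<^sub>m 1 n) (0\<^sub>m n 1) B * mat_adjoint U"
      using hermitian_deflation[OF Suc.prems] by blast
    obtain V l where V: "unitary n V" and B_eq: "B = unitary_diag n V l"
      using Suc.IH[OF B] by blast
    define F where "F = four_block_mat (1\<^sub>m 1) (0\<^sub>m 1 n) (0\<^sub>m n 1) V"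
    have "unitary 1 (1\<^sub>m 1 :: complex mat)" by (auto simp: unitary_def intro!: eq_matI)
    from unitary_four_block_diag[OF this V] have F: "unitary ?N F" by (simp add: F_def)
    define D where "D = mat_diag ?N (\<lambda>i. complex_of_real (case i of 0 \<Rightarrow> e | Suc j \<Rightarrow> l j))"
    have D_blocks: "D = four_block_mat (mat 1 1 (\<lambda>_. of_real e)) (0\<^sub>m 1 n) (0\<^sub>m n 1)
        (mat_diag n (\<lambda>i. of_real (l i)))"
      by (rule eq_matI) (auto simp: D_def mat_diag_def split: nat.splits)
    have F_adj: "mat_adjoint F = four_block_mat (1\<^sub>m 1) (0\<^sub>m 1 n) (0\<^sub>m n 1) (mat_adjoint V)"
      unfolding F_def using unitaryD(1)[OF V]
      by (subst mat_adjoint_four_block_diag) (auto intro!: cong_four_block_mat eq_matI)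
    have "four_block_mat (mat 1 1 (\<lambda>_. of_real e)) (0\<^sub>m 1 n) (0\<^sub>m n 1) B = F * D * mat_adjoint F"
      unfolding D_blocks F_adj unfolding F_def B_eq using unitaryD(1)[OF V]
      by (simp add: mult_four_block_diag[of _ 1 _ _ n] mult_carrier_mat[of _ n n _ n] del: One_nat_def)
    then have "A = (U * F) * D * mat_adjoint (U * F)"
      using unitaryD(1)[OF U] unitaryD(1)[OF F]
      by (simp add: A_eq D_def mat_adjoint_mult[of _ ?N ?N _ ?N] assoc_mult_mat[of _ ?N ?N _ ?N _ ?N]
          mult_carrier_mat[of _ ?N ?N _ ?N])
    then show ?case using unitary_mult[OF U F] by (auto simp: D_def)
  qed
  then show ?thesis using that by blast
qed

section \<open>Positive semidefinite matrices\<close>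

lemma mult_mat_vec_cscalar_prod_sum:
  fixes A :: "complex mat"
  assumes "A \<in> carrier_mat n n" "v \<in> carrier_vec n"
  shows "(A *\<^sub>v v) \<bullet>c v = (\<Sum>i<n. \<Sum>j<n. cnj (v $ i) * A $$ (i, j) * v $ j)"
  using assms
  by (auto simp: scalar_prod_def atLeast0LessThan sum_distrib_left sum_distrib_right mult_ac
      intro!: sum.cong)

lemma psd_iff:
  "psd n A \<longleftrightarrow> A \<in> carrier_mat n n \<and> mat_adjoint A = A \<and> (\<forall>v\<in>carrier_vec n. 0 \<le> (A *\<^sub>v v) \<bullet>c v)"
proof (cases "A \<in> carrier_mat n n")
  case True
  have "(\<forall>i<n. \<forall>j<n. A $$ (i, j) = cnj (A $$ (j, i))) \<longleftrightarrow> mat_adjoint A = A"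
    unfolding mat_adjoint_eq_self_iff[OF True] conjugate_complex_def by metis
  with True show ?thesis
    by (simp add: psd_def mult_mat_vec_cscalar_prod_sum less_eq_complex_def conj_commute)
qed (simp add: psd_def)

lemma psdD:
  assumes "psd n A"
  shows "A \<in> carrier_mat n n" "mat_adjoint A = A" "v \<in> carrier_vec n \<Longrightarrow> 0 \<le> (A *\<^sub>v v) \<bullet>c v"
  using assms by (auto simp: psd_iff)

lemma psd_one: "psd n (1\<^sub>m n)"
  unfolding psd_iff by (auto intro!: eq_matI)

lemma psd_conj:
  assumes A: "psd n A" and V: "V \<in> carrier_mat n m"
  shows "psd m (mat_adjoint V * A * V)"
  unfolding psd_iff
proof (intro conjI ballI)
  note [simp] = psdD(1,2)[OF A] V mat_adjoint_carrier[OF V]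
    mult_carrier_mat[of _ m n _ n] mult_carrier_mat[of _ n n _ m] mult_mat_vec_carrier[of A n n]
    mult_mat_vec_carrier[of V n m]
  show "mat_adjoint V * A * V \<in> carrier_mat m m" by (intro mult_carrier_mat[of _ m n]) simp_all
  show "mat_adjoint (mat_adjoint V * A * V) = mat_adjoint V * A * V"
    by (simp add: mat_adjoint_mult[of _ m n _ m] mat_adjoint_mult[of _ n n _ m]
        assoc_mult_mat[of _ m n _ n _ m])
  show "0 \<le> ((mat_adjoint V * A * V) *\<^sub>v v) \<bullet>c v" if v: "v \<in> carrier_vec m" for v
  proof -
    have "(mat_adjoint V * A * V) *\<^sub>v v = mat_adjoint V *\<^sub>v (A *\<^sub>v (V *\<^sub>v v))"
      using v by (simp add: assoc_mult_mat[of _ m n _ n _ m] assoc_mult_mat_vec[of _ m n _ m]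
          assoc_mult_mat_vec[of _ n n _ m])
    then have "((mat_adjoint V * A * V) *\<^sub>v v) \<bullet>c v = (A *\<^sub>v (V *\<^sub>v v)) \<bullet>c (V *\<^sub>v v)"
      using v mult_mat_vec_cscalar_prod[of "mat_adjoint V" m n "A *\<^sub>v (V *\<^sub>v v)" v] by simp
    then show ?thesis using psdD(3)[OF A, of "V *\<^sub>v v"] v by simp
  qed
qed

lemma psd_mult_adjoint:
  assumes "W \<in> carrier_mat n m"
  shows "psd n (W * mat_adjoint W)"
  using psd_conj[OF psd_one mat_adjoint_carrier[OF assms]] right_mult_one_mat[OF assms] by simp

lemma psd_adjoint_mult:
  assumes "W \<in> carrier_mat m n"
  shows "psd n (mat_adjoint W * W)"
  using psd_mult_adjoint[OF mat_adjoint_carrier[OF assms]] by simp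

lemma mat_diag_sqrt_mult_self:
  assumes "\<And>i. i < n \<Longrightarrow> 0 \<le> l i"
  shows "mat_diag n (\<lambda>i. complex_of_real (sqrt (l i))) * mat_diag n (\<lambda>i. of_real (sqrt (l i))) =
    mat_diag n (\<lambda>i. of_real (l i))"
  unfolding mat_diag_diag
  by (rule eq_matI) (use assms in \<open>auto simp: mat_diag_def simp flip: of_real_mult\<close>)

lemma psd_mat_diag:
  fixes l :: "nat \<Rightarrow> real"
  assumes "\<And>i. i < n \<Longrightarrow> 0 \<le> l i"
  shows "psd n (mat_diag n (\<lambda>i. of_real (l i)))"
  using psd_mult_adjoint[OF mat_diag_dim, of n "\<lambda>i. of_real (sqrt (l i))"]
    mat_diag_sqrt_mult_self[of n l] assms by simp

lemma psd_principal_submatrix: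
  assumes A: "psd n A" and f: "\<And>i. i < m \<Longrightarrow> f i < n"
  shows "psd m (mat m m (\<lambda>(i, j). A $$ (f i, f j)))"
proof -
  define E where "E = mat n m (\<lambda>(r, i). if r = f i then 1 else 0 :: complex)"
  have E: "E \<in> carrier_mat n m" by (simp add: E_def)
  have E_index: "E $$ (r, i) = (if r = f i then 1 else 0)" if "r < n" "i < m" for r i
    using that by (simp add: E_def)
  have AE_index: "(A * E) $$ (r, j) = A $$ (r, f j)" if "r < n" "j < m" for r j
    using that f[of j]
    by (subst index_mult_mat_sum[OF psdD(1)[OF A] E]) (auto simp: E_index if_distrib cong: if_cong)
  have "(mat_adjoint E * (A * E)) $$ (i, j) = A $$ (f i, f j)" if "i < m" "j < m" for i j
  proof -
    have "(mat_adjoint E * (A * E)) $$ (i, j) = (\<Sum>r<n. (if r = f i then A $$ (r, f j) else 0))"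
      unfolding index_mult_mat_sum[OF mat_adjoint_carrier[OF E]
          mult_carrier_mat[OF psdD(1)[OF A] E] that]
      by (intro sum.cong refl) (use that E in \<open>auto simp: E_index AE_index simp del: index_mult_mat(1)\<close>)
    then show ?thesis using f[OF that(1)] by simp
  qed
  then have "mat_adjoint E * A * E = mat m m (\<lambda>(i, j). A $$ (f i, f j))"
    by (intro eq_matI) (use E psdD(1)[OF A] in \<open>auto simp: assoc_mult_mat[of _ m n _ n _ m]\<close>)
  then show ?thesis using psd_conj[OF A E] by simp
qed

lemma psd_nonneg_combination:
  assumes A: "A \<in> carrier_mat n n" and G: "\<And>x. x \<in> I \<Longrightarrow> psd n (G x)"
    and p: "\<And>x. x \<in> I \<Longrightarrow> 0 \<le> p x"
    and sum: "\<And>i j. i < n \<Longrightarrow> j < n \<Longrightarrow> A $$ (i, j) = (\<Sum>x\<in>I. of_real (p x) * G x $$ (i, j))"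
  shows "psd n A"
  unfolding psd_iff
proof (intro conjI ballI)
  have "cnj (G x $$ (j, i)) = G x $$ (i, j)" if "x \<in> I" "i < n" "j < n" for x i j
    using psdD(2)[OF G[OF that(1)]] that
    by (simp add: mat_adjoint_eq_self_iff[OF psdD(1)[OF G[OF that(1)]]])
  then show "mat_adjoint A = A"
    by (auto simp: mat_adjoint_eq_self_iff[OF A] sum intro!: sum.cong)
  show "0 \<le> (A *\<^sub>v v) \<bullet>c v" if v: "v \<in> carrier_vec n" for v
  proof -
    have "(A *\<^sub>v v) \<bullet>c v = (\<Sum>i<n. \<Sum>j<n. \<Sum>x\<in>I. of_real (p x) * (cnj (v $ i) * G x $$ (i, j) * v $ j))"
      unfolding mult_mat_vec_cscalar_prod_sum[OF A v]
      by (intro sum.cong refl) (simp add: sum sum_distrib_left sum_distrib_right mult_ac)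
    also have "\<dots> = (\<Sum>x\<in>I. \<Sum>i<n. \<Sum>j<n. of_real (p x) * (cnj (v $ i) * G x $$ (i, j) * v $ j))"
      by (simp only: sum.swap[where B = I])
    also have "\<dots> = (\<Sum>x\<in>I. of_real (p x) * ((G x *\<^sub>v v) \<bullet>c v))"
      by (intro sum.cong refl)
        (simp add: mult_mat_vec_cscalar_prod_sum[OF psdD(1)[OF G] v] sum_distrib_left)
    also have "\<dots> \<ge> 0"
      using p psdD(3)[OF G v] by (intro sum_nonneg mult_nonneg_nonneg) (auto simp: less_eq_complex_def)
    finally show ?thesis .
  qed
qed (rule A)

lemma psd_smult:
  assumes "psd n A" "0 \<le> c"
  shows "psd n (of_real c \<cdot>\<^sub>m A)"
  by (rule psd_nonneg_combination[where I = "{()}" and p = "\<lambda>_. c" and G = "\<lambda>_. A"])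
    (use assms psdD(1)[OF assms(1)] in auto)

lemma psd_diag_nonneg:
  assumes A: "psd n A" and i: "i < n"
  shows "0 \<le> A $$ (i, i)"
proof -
  have "psd 1 (mat 1 1 (\<lambda>(a, b). A $$ (i, i)))"
    using psd_principal_submatrix[OF A, of 1 "\<lambda>_. i"] i by simp
  from psdD(3)[OF this, of "unit_vec 1 0"] show ?thesis
    by (simp add: mult_mat_vec_cscalar_prod_sum[of _ 1])
qed

lemma psd_spectral:
  assumes "psd n A"
  obtains U l where "unitary n U" "\<And>i. i < n \<Longrightarrow> 0 \<le> l i" "A = unitary_diag n U l"
proof -
  obtain U l where U: "unitary n U" and A_eq: "A = unitary_diag n U l"
    using hermitian_unitary_diagonalization[OF psdD(1,2)[OF assms]] by blast
  let ?D = "mat_diag n (\<lambda>i. complex_of_real (l i))"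
  have "psd n ?D"
    using psd_conj[OF assms unitaryD(1)[OF U]]
    by (simp only: A_eq unitary_conj_cancel[OF U mat_diag_dim])
  then have "0 \<le> l i" if "i < n" for i
    using psd_diag_nonneg[of n ?D i] that by (simp add: mat_diag_def less_eq_complex_def)
  then show ?thesis using that U A_eq by blast
qed

lemma psd_eq_mult_adjoint:
  assumes "psd n A"
  obtains W where "W \<in> carrier_mat n n" "A = W * mat_adjoint W"
proof -
  obtain U l where U: "unitary n U" and l_nonneg: "\<And>i. i < n \<Longrightarrow> 0 \<le> l i" and A: "A = unitary_diag n U l"
    using psd_spectral[OF assms] by blast
  let ?R = "mat_diag n (\<lambda>i. complex_of_real (sqrt (l i)))"
  have "(U * ?R) * mat_adjoint (U * ?R) = U * (?R * ?R) * mat_adjoint U"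
    using unitaryD(1)[OF U]
    by (simp add: mat_adjoint_mult[of _ n n _ n] assoc_mult_mat[of _ n n _ n _ n]
        mult_carrier_mat[of _ n n _ n] del: mat_diag_diag)
  then have "A = (U * ?R) * mat_adjoint (U * ?R)"
    by (simp only: A mat_diag_sqrt_mult_self[OF l_nonneg])
  then show ?thesis
    using that[of "U * ?R"] unitaryD(1)[OF U] by (simp add: mult_carrier_mat[of _ n n _ n])
qed

section \<open>Traces and density matrices\<close>

lemma mtrace_mult_commute:
  assumes "A \<in> carrier_mat n m" "B \<in> carrier_mat m n"
  shows "mtrace (A * B) = mtrace (B * A)"
proof -
  have "mtrace (A * B) = (\<Sum>i<n. \<Sum>x<m. A $$ (i, x) * B $$ (x, i))"
    unfolding mtrace_def using assms
    by (auto intro!: sum.cong index_mult_mat_sum simp del: index_mult_mat(1))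
  also have "\<dots> = (\<Sum>x<m. \<Sum>i<n. B $$ (x, i) * A $$ (i, x))"
    by (subst sum.swap) (simp add: mult.commute)
  also have "\<dots> = mtrace (B * A)"
    unfolding mtrace_def using assms
    by (auto intro!: sum.cong index_mult_mat_sum[symmetric] simp del: index_mult_mat(1))
  finally show ?thesis .
qed

lemma mtrace_smult: "mtrace (c \<cdot>\<^sub>m A) = c * mtrace A" if "A \<in> carrier_mat n n"
  using that by (auto simp: mtrace_def sum_distrib_left)

lemma mtrace_mat_diag: "mtrace (mat_diag n f) = (\<Sum>i<n. f i)"
  by (simp add: mtrace_def mat_diag_def)

lemma mtrace_unitary_conj:
  assumes "unitary n U" "A \<in> carrier_mat n n"
  shows "mtrace (U * A * mat_adjoint U) = mtrace A"
proof -
  have "mtrace (U * A * mat_adjoint U) = mtrace (mat_adjoint U * (U * A))"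
    by (rule mtrace_mult_commute[of _ n n])
      (use unitaryD(1)[OF assms(1)] assms(2) in \<open>auto intro: mult_carrier_mat\<close>)
  then show ?thesis by (simp only: unitary_adjoint_mult_cancel[OF assms])
qed

lemma mtrace_unitary_diag:
  assumes "unitary n U"
  shows "mtrace (unitary_diag n U l) = of_real (\<Sum>i<n. l i)"
  using mtrace_unitary_conj[OF assms mat_diag_dim] by (simp add: mtrace_mat_diag)

lemma psd_mtrace:
  assumes "psd n A"
  shows "0 \<le> Re (mtrace A)" "of_real (Re (mtrace A)) = mtrace A"
proof -
  have "0 \<le> mtrace A"
    unfolding mtrace_def using psd_diag_nonneg[OF assms] psdD(1)[OF assms] by (intro sum_nonneg) auto
  then show "0 \<le> Re (mtrace A)" "of_real (Re (mtrace A)) = mtrace A"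
    by (simp_all add: less_eq_complex_def complex_eq_iff)
qed

lemma densityD:
  assumes "density n A"
  shows "psd n A" "A \<in> carrier_mat n n" "mtrace A = 1"
  using assms psdD(1)[of n A] by (simp_all add: density_def)

lemma density_dim_pos: "density n A \<Longrightarrow> 0 < n"
  using densityD(2,3)[of n A] by (cases n) (auto simp: mtrace_def)

lemma density_spectral:
  assumes "density n A"
  obtains U l where "unitary n U" "\<And>i. i < n \<Longrightarrow> 0 \<le> l i" "(\<Sum>i<n. l i) = 1" "A = unitary_diag n U l"
proof -
  obtain U l where U: "unitary n U" and l_nonneg: "\<And>i. i < n \<Longrightarrow> 0 \<le> l i" and A: "A = unitary_diag n U l"
    using psd_spectral[OF densityD(1)[OF assms]] by blast
  have "(\<Sum>i<n. l i) = 1"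
    using densityD(3)[OF assms] by (simp only: A mtrace_unitary_diag[OF U] of_real_eq_1_iff)
  then show ?thesis using that U l_nonneg A by blast
qed

lemma density_unitary_conj:
  assumes "unitary n U" "density n A"
  shows "density n (U * A * mat_adjoint U)"
  using psd_conj[OF densityD(1)[OF assms(2)] mat_adjoint_carrier[OF unitaryD(1)[OF assms(1)]]]
    mtrace_unitary_conj[OF assms(1) densityD(2)[OF assms(2)]] densityD(3)[OF assms(2)]
  by (simp add: density_def)

lemma mat_unit_diag: "mat_unit n i i = mat_diag n (\<lambda>x. of_real (if x = i then 1 else 0))"
  by (rule eq_matI) (auto simp: mat_unit_def mat_diag_def)

lemma density_mat_unit:
  assumes "i < n"
  shows "density n (mat_unit n i i)"
  unfolding density_def mat_unit_diag mtrace_mat_diag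
  using assms by (intro conjI psd_mat_diag) (auto simp flip: of_real_sum)

lemma psd_mtrace_eq_0:
  assumes "psd n A" "mtrace A = 0"
  shows "A = 0\<^sub>m n n"
proof -
  obtain U l where U: "unitary n U" and l_nonneg: "\<And>i. i < n \<Longrightarrow> 0 \<le> l i" and A: "A = unitary_diag n U l"
    using psd_spectral[OF assms(1)] by blast
  have "(\<Sum>i<n. l i) = 0"
    using assms(2) by (simp only: A mtrace_unitary_diag[OF U] of_real_eq_0_iff)
  then have "l i = 0" if "i < n" for i
    using l_nonneg that by (subst (asm) sum_nonneg_eq_0_iff) auto
  then have "mat_diag n (\<lambda>i. complex_of_real (l i)) = 0\<^sub>m n n"
    by (intro eq_matI) (auto simp: mat_diag_def)
  then show ?thesis using unitaryD(1)[OF U] by (simp add: A)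
qed

lemma psd_eq_smult_density:
  assumes A: "psd n A" and n: "0 < n"
  obtains T where "density n T" "A = of_real (Re (mtrace A)) \<cdot>\<^sub>m T"
proof (cases "mtrace A = 0")
  case True
  then have "A = of_real (Re (mtrace A)) \<cdot>\<^sub>m mat_unit n 0 0"
    using psd_mtrace_eq_0[OF A] by (auto simp: mat_unit_def)
  then show ?thesis using that density_mat_unit[OF n] by blast
next
  case False
  define t where "t = Re (mtrace A)"
  have t_pos: "t > 0" "mtrace A = of_real t"
    using psd_mtrace[OF A] False by (auto simp: t_def less_le)
  have "density n (of_real (1 / t) \<cdot>\<^sub>m A)"
    unfolding density_def using psd_smult[OF A, of "1 / t"] t_pos mtrace_smult[OF psdD(1)[OF A]] by simp
  moreover have "A = of_real t \<cdot>\<^sub>m (of_real (1 / t) \<cdot>\<^sub>m A)"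
    by (rule eq_matI) (use t_pos in auto)
  ultimately show ?thesis using that by (simp add: t_def)
qed

section \<open>Von Neumann entropy\<close>

lemma char_poly_four_block_upper_right_zero:
  fixes A :: "'a :: idom mat"
  assumes "A \<in> carrier_mat m m" "C \<in> carrier_mat n m" "D \<in> carrier_mat n n"
  shows "char_poly (four_block_mat A (0\<^sub>m m n) C D) = char_poly A * char_poly D"
proof -
  have "char_poly_matrix (four_block_mat A (0\<^sub>m m n) C D) =
      four_block_mat (char_poly_matrix A) (0\<^sub>m m n) (map_mat (\<lambda>a. [:- a:]) C) (char_poly_matrix D)"
    unfolding char_poly_matrix_def by (rule eq_matI) (use assms in auto)
  then show ?thesis
    unfolding char_poly_def
    using assms by (simp add: det_four_block_mat_upper_right_zero[of _ m _ n])
qed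

lemma char_poly_zero_mat: "char_poly (0\<^sub>m n n :: 'a :: idom mat) = [:0, 1:] ^ n"
proof -
  have "diag_mat (0\<^sub>m n n :: 'a mat) = replicate n 0"
    by (rule nth_equalityI) (auto simp: diag_mat_def)
  then show ?thesis
    by (subst char_poly_upper_triangular[of _ n]) (auto simp: prod_list_replicate)
qed

lemma char_poly_mult_commute:
  fixes A B :: "'a :: idom mat"
  assumes A: "A \<in> carrier_mat m n" and B: "B \<in> carrier_mat n m"
  shows "char_poly (A * B) * [:0, 1:] ^ n = [:0, 1:] ^ m * char_poly (B * A)"
proof -
  \<comment> \<open>Bordering \<open>A * B\<close> and \<open>B * A\<close> by zero rows and columns turns them into similar block matrices.\<close>
  define M where "M = four_block_mat (A * B) (0\<^sub>m m n) B (0\<^sub>m n n)"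
  define N where "N = four_block_mat (0\<^sub>m m m) (0\<^sub>m m n) B (B * A)"
  define P where "P = four_block_mat (1\<^sub>m m) A (0\<^sub>m n m) (1\<^sub>m n)"
  define Q where "Q = four_block_mat (1\<^sub>m m) (- A) (0\<^sub>m n m) (1\<^sub>m n)"
  note [simp] = A B mult_carrier_mat[OF A B] mult_carrier_mat[OF B A]
    mult_carrier_mat[of A m n "B * A" n] mult_carrier_mat[of "A * B" m m A n]
    left_mult_one_mat[of _ m n] left_mult_one_mat[of _ n m] left_mult_one_mat[of _ n n]
    right_mult_one_mat[of _ m n] right_mult_one_mat[of _ m m] right_mult_one_mat[of _ n m]
    left_mult_zero_mat[of _ m n] right_mult_zero_mat[of _ m n]
    uminus_l_inv_mat[OF A] add_uminus_minus_mat[OF A A] minus_r_inv_mat[OF A]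
  note mult_blocks = mult_four_block_mat[of _ m m _ n _ n _ _ m _ n]
  have inverse: "P * Q = 1\<^sub>m (m + n)" "Q * P = 1\<^sub>m (m + n)"
    unfolding P_def Q_def by (subst mult_blocks; simp)+
  have "P * N = four_block_mat (A * B) (A * (B * A)) B (B * A)"
    unfolding P_def N_def by (subst mult_blocks; simp)
  also have "\<dots> = M * P"
    unfolding P_def M_def by (subst mult_blocks; simp add: assoc_mult_mat[OF A B A])
  finally have intertwine: "P * N = M * P" .
  have carrier: "{M, N, P, Q} \<subseteq> carrier_mat (m + n) (m + n)"
    unfolding M_def N_def P_def Q_def by (auto intro!: four_block_carrier_mat)
  then have "M = P * N * Q"
    unfolding intertwine using inverse(1)
    by (simp add: assoc_mult_mat[of _ "m + n" "m + n" _ "m + n" _ "m + n"]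
        right_mult_one_mat[of _ "m + n" "m + n"])
  then have "char_poly M = char_poly N"
    using similar_matI[OF carrier inverse] by (intro char_poly_similar)
  then show ?thesis
    by (simp add: M_def N_def char_poly_four_block_upper_right_zero char_poly_zero_mat)
qed

lemma char_poly_nonzero:
  fixes A :: "complex mat"
  shows "A \<in> carrier_mat n n \<Longrightarrow> char_poly A \<noteq> 0"
  using degree_monic_char_poly[of A n] by auto

lemma eta_0 [simp]: "eta 0 = 0"
  by (simp add: eta_def)

lemma eta_1 [simp]: "eta 1 = 0"
  by (simp add: eta_def)

lemma eta_nonpos: "x \<le> 1 \<Longrightarrow> eta x \<le> 0"
  by (auto simp: eta_def mult_nonneg_nonpos)

lemma eta_mult:
  assumes "0 \<le> x" "0 \<le> y"
  shows "eta (x * y) = x * eta y + y * eta x"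
  using assms by (cases "x = 0"; cases "y = 0")
    (auto simp: eta_def mult_le_0_iff ln_mult algebra_simps)

lemma vn_entropy_mult_commute:
  assumes A: "A \<in> carrier_mat m n" and B: "B \<in> carrier_mat n m"
  shows "vn_entropy (A * B) = vn_entropy (B * A)"
proof -
  let ?S = "\<lambda>p :: complex poly. \<Sum>z\<in>#proots p. eta (Re z)"
  have sum_proots_mult_X: "?S (p * [:0, 1:] ^ i) = ?S p" if "p \<noteq> 0" for i p
    using that by (subst proots_mult)
      (auto simp: proots_power proots_linear_factor[of 0, simplified] sum_mset_constant)
  have "?S (char_poly (A * B)) = ?S (char_poly (A * B) * [:0, 1:] ^ n)"
    by (rule sum_proots_mult_X[symmetric], rule char_poly_nonzero[of _ m]) (use A B in auto)
  also have "\<dots> = ?S (char_poly (B * A) * [:0, 1:] ^ m)"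
    by (simp only: char_poly_mult_commute[OF A B] mult.commute)
  also have "\<dots> = ?S (char_poly (B * A))"
    by (rule sum_proots_mult_X, rule char_poly_nonzero[of _ n]) (use A B in auto)
  finally show ?thesis by (simp add: vn_entropy_def)
qed

lemma vn_entropy_four_block_diag:
  assumes A: "A \<in> carrier_mat m m" and D: "D \<in> carrier_mat n n"
  shows "vn_entropy (four_block_mat A (0\<^sub>m m n) (0\<^sub>m n m) D) = vn_entropy A + vn_entropy D"
  using char_poly_nonzero[OF A] char_poly_nonzero[OF D]
  by (simp add: vn_entropy_def char_poly_four_block_upper_right_zero[OF A _ D] proots_mult)

lemma proots_prod_linear_factors:
  "proots (\<Prod>a\<leftarrow>xs. [:- a, 1:]) = mset (xs :: 'a :: idom list)"
proof (induction xs)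
  case (Cons x xs)
  have "(\<Prod>a\<leftarrow>xs. [:- a, 1:]) \<noteq> 0"
    by (auto simp: prod_list_zero_iff)
  with Cons show ?case by (simp add: proots_mult del: mult_pCons_left)
qed simp

lemma vn_entropy_mat_diag: "vn_entropy (mat_diag n f) = - (\<Sum>i<n. eta (Re (f i)))"
proof -
  have "char_poly (mat_diag n f) = (\<Prod>a\<leftarrow>diag_mat (mat_diag n f). [:- a, 1:])"
    by (rule char_poly_upper_triangular[of _ n]) (auto simp: upper_triangular_def mat_diag_def)
  moreover have "diag_mat (mat_diag n f) = map f [0..<n]"
    by (auto simp: diag_mat_def mat_diag_def)
  ultimately have "proots (char_poly (mat_diag n f)) = image_mset f (mset [0..<n])"
    by (simp only: proots_prod_linear_factors mset_map)
  then show ?thesis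
    by (simp add: vn_entropy_def image_mset.compositionality comp_def sum_unfold_sum_mset
        atLeast0LessThan)
qed

lemma vn_entropy_unitary_conj:
  assumes "unitary n U" "A \<in> carrier_mat n n"
  shows "vn_entropy (U * A * mat_adjoint U) = vn_entropy A"
proof -
  have "vn_entropy (U * A * mat_adjoint U) = vn_entropy (mat_adjoint U * (U * A))"
    by (rule vn_entropy_mult_commute[of _ n n])
      (use unitaryD(1)[OF assms(1)] assms(2) in \<open>auto intro: mult_carrier_mat\<close>)
  then show ?thesis by (simp only: unitary_adjoint_mult_cancel[OF assms])
qed

lemma vn_entropy_unitary_diag:
  assumes "unitary n U"
  shows "vn_entropy (unitary_diag n U l) = - (\<Sum>i<n. eta (l i))"
  using vn_entropy_unitary_conj[OF assms mat_diag_dim] by (simp add: vn_entropy_mat_diag)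

lemma vn_entropy_smult:
  assumes "psd n A" "0 \<le> c"
  shows "vn_entropy (of_real c \<cdot>\<^sub>m A) = c * vn_entropy A - eta c * Re (mtrace A)"
proof -
  obtain U l where U: "unitary n U" and l_nonneg: "\<And>i. i < n \<Longrightarrow> 0 \<le> l i" and A: "A = unitary_diag n U l"
    using psd_spectral[OF assms(1)] by blast
  have "of_real c \<cdot>\<^sub>m mat_diag n (\<lambda>i. of_real (l i)) = mat_diag n (\<lambda>i. complex_of_real (c * l i))"
    by (rule eq_matI) (auto simp: mat_diag_def)
  then have "of_real c \<cdot>\<^sub>m A = unitary_diag n U (\<lambda>i. c * l i)"
    unfolding A using unitaryD(1)[OF U]
    by (metis mat_adjoint_carrier mat_diag_dim mult_carrier_mat mult_smult_assoc_mat mult_smult_distrib)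
  then have "vn_entropy (of_real c \<cdot>\<^sub>m A) = - (\<Sum>i<n. eta (c * l i))"
    by (simp only: vn_entropy_unitary_diag[OF U])
  also have "(\<Sum>i<n. eta (c * l i)) = (\<Sum>i<n. c * eta (l i) + l i * eta c)"
    by (intro sum.cong refl eta_mult) (use l_nonneg assms(2) in auto)
  finally show ?thesis
    unfolding A vn_entropy_unitary_diag[OF U] mtrace_unitary_diag[OF U]
    by (simp add: sum.distrib sum_distrib_left sum_distrib_right mult.commute)
qed

lemma vn_entropy_density_nonneg:
  assumes "density n A"
  shows "0 \<le> vn_entropy A"
proof -
  obtain U l where U: "unitary n U" and l_nonneg: "\<And>i. i < n \<Longrightarrow> 0 \<le> l i"
    and l_sum: "(\<Sum>i<n. l i) = 1" and A: "A = unitary_diag n U l"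
    using density_spectral[OF assms] by blast
  have "eta (l i) \<le> 0" if "i < n" for i
    using member_le_sum[of i "{..<n}" l] l_nonneg l_sum that by (intro eta_nonpos) simp
  then show ?thesis
    by (auto simp: A vn_entropy_unitary_diag[OF U] intro: sum_nonpos)
qed

section \<open>Ensembles of density matrices\<close>

definition ensemble ::
  "nat \<Rightarrow> 'i set \<Rightarrow> ('i \<Rightarrow> real) \<Rightarrow> ('i \<Rightarrow> complex mat) \<Rightarrow> complex mat \<Rightarrow> bool" where
  "ensemble n I p T A \<longleftrightarrow> finite I \<and> (\<forall>x\<in>I. 0 \<le> p x \<and> density n (T x)) \<and> (\<Sum>x\<in>I. p x) = 1 \<and>
     A \<in> carrier_mat n n \<and> (\<forall>i<n. \<forall>j<n. A $$ (i, j) = (\<Sum>x\<in>I. of_real (p x) * T x $$ (i, j)))"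

lemma ensembleI:
  assumes "finite I" "\<And>x. x \<in> I \<Longrightarrow> 0 \<le> p x" "\<And>x. x \<in> I \<Longrightarrow> density n (T x)" "(\<Sum>x\<in>I. p x) = 1"
    "A \<in> carrier_mat n n"
    "\<And>i j. i < n \<Longrightarrow> j < n \<Longrightarrow> A $$ (i, j) = (\<Sum>x\<in>I. of_real (p x) * T x $$ (i, j))"
  shows "ensemble n I p T A"
  using assms by (simp add: ensemble_def)

lemma ensembleD:
  assumes "ensemble n I p T A"
  shows "finite I" "\<And>x. x \<in> I \<Longrightarrow> 0 \<le> p x" "\<And>x. x \<in> I \<Longrightarrow> density n (T x)" "(\<Sum>x\<in>I. p x) = 1"
    "A \<in> carrier_mat n n"
    "\<And>i j. i < n \<Longrightarrow> j < n \<Longrightarrow> A $$ (i, j) = (\<Sum>x\<in>I. of_real (p x) * T x $$ (i, j))"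
  using assms by (simp_all add: ensemble_def)

lemma ensemble_psd: "ensemble n I p T A \<Longrightarrow> psd n A"
  by (rule psd_nonneg_combination[where p = p and G = T and I = I]) (auto dest: ensembleD densityD)

lemma index_conj:
  fixes U A :: "complex mat"
  assumes "U \<in> carrier_mat m n" "A \<in> carrier_mat n n" "i < m" "j < m"
  shows "(U * A * mat_adjoint U) $$ (i, j) = (\<Sum>s<n. \<Sum>r<n. U $$ (i, r) * A $$ (r, s) * cnj (U $$ (j, s)))"
proof -
  have "(U * A * mat_adjoint U) $$ (i, j) = (\<Sum>s<n. (U * A) $$ (i, s) * cnj (U $$ (j, s)))"
    using assms by (subst index_mult_mat_sum[of _ m n _ m]) (auto simp del: index_mult_mat(1))
  also have "\<dots> = (\<Sum>s<n. \<Sum>r<n. U $$ (i, r) * A $$ (r, s) * cnj (U $$ (j, s)))"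
    using assms
    by (intro sum.cong refl)
      (simp add: index_mult_mat_sum[of _ m n _ n] sum_distrib_right del: index_mult_mat(1))
  finally show ?thesis .
qed

lemma ensemble_unitary_conj:
  assumes ens: "ensemble n I p T A" and U: "unitary n U"
  shows "ensemble n I p (\<lambda>x. U * T x * mat_adjoint U) (U * A * mat_adjoint U)"
proof (rule ensembleI)
  note entry = index_conj[OF unitaryD(1)[OF U]]
  show "(U * A * mat_adjoint U) $$ (i, j) = (\<Sum>x\<in>I. of_real (p x) * (U * T x * mat_adjoint U) $$ (i, j))"
    if ij: "i < n" "j < n" for i j
  proof -
    have "(U * A * mat_adjoint U) $$ (i, j) =
        (\<Sum>s<n. \<Sum>r<n. \<Sum>x\<in>I. of_real (p x) * (U $$ (i, r) * T x $$ (r, s) * cnj (U $$ (j, s))))"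
      unfolding entry[OF ensembleD(5)[OF ens] ij]
      by (intro sum.cong refl)
        (simp add: ensembleD(6)[OF ens] sum_distrib_left sum_distrib_right mult_ac)
    also have "\<dots> = (\<Sum>x\<in>I. \<Sum>s<n. \<Sum>r<n. of_real (p x) * (U $$ (i, r) * T x $$ (r, s) * cnj (U $$ (j, s))))"
      by (simp only: sum.swap[where B = I])
    also have "\<dots> = (\<Sum>x\<in>I. of_real (p x) * (U * T x * mat_adjoint U) $$ (i, j))"
      by (intro sum.cong refl)
        (simp add: entry[OF densityD(2)[OF ensembleD(3)[OF ens]] ij] sum_distrib_left)
    finally show ?thesis .
  qed
qed (use ensembleD[OF ens] density_unitary_conj[OF U] unitaryD(1)[OF U] in
    \<open>auto intro: mult_carrier_mat[of _ n n _ n]\<close>)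

lemma ensemble_singleton: "density n A \<Longrightarrow> ensemble n {x} (\<lambda>_. 1) (\<lambda>_. A) A"
  by (rule ensembleI) (auto dest: densityD)

lemma ensemble_reindex:
  assumes h: "bij_betw h J I" and ens: "ensemble n I p T A"
  shows "ensemble n J (p \<circ> h) (T \<circ> h) A"
proof (rule ensembleI)
  show "finite J" using bij_betw_finite[OF h] ensembleD(1)[OF ens] by simp
  have "h x \<in> I" if "x \<in> J" for x using bij_betwE[OF h] that by simp
  then show "0 \<le> (p \<circ> h) x" "density n ((T \<circ> h) x)" if "x \<in> J" for x
    using ensembleD(2,3)[OF ens] that by auto
qed (use ensembleD(4-6)[OF ens] in \<open>auto simp flip: sum.reindex_bij_betw[OF h]\<close>)

lemma ensemble_refine:
  assumes ens: "ensemble n I p T A" and ens_T: "\<And>x. x \<in> I \<Longrightarrow> ensemble n (J x) (q x) (R x) (T x)"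
  shows "ensemble n (SIGMA x:I. J x) (\<lambda>(x, j). p x * q x j) (\<lambda>(x, j). R x j) A"
proof (rule ensembleI)
  have fin: "finite I" "\<forall>x\<in>I. finite (J x)" using ensembleD(1)[OF ens] ensembleD(1)[OF ens_T] by auto
  note Sigma = sum.Sigma[OF fin, symmetric]
  show "(\<Sum>z\<in>(SIGMA x:I. J x). case z of (x, j) \<Rightarrow> p x * q x j) = 1"
    using ensembleD(4)[OF ens] ensembleD(4)[OF ens_T] by (simp add: Sigma flip: sum_distrib_left)
  show "A $$ (i, j) = (\<Sum>z\<in>(SIGMA x:I. J x). of_real (case z of (x, j) \<Rightarrow> p x * q x j) *
      (case z of (x, j) \<Rightarrow> R x j) $$ (i, j))" if "i < n" "j < n" for i j
  proof -
    have "A $$ (i, j) = (\<Sum>x\<in>I. \<Sum>z\<in>J x. of_real (p x * q x z) * R x z $$ (i, j))"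
      using that by (simp add: ensembleD(6)[OF ens] ensembleD(6)[OF ens_T] sum_distrib_left mult_ac)
    then show ?thesis unfolding sum.Sigma[OF fin] by (simp add: split_def)
  qed
qed (use ensembleD[OF ens] ensembleD[OF ens_T] in auto)

lemma density_pure_ensemble:
  assumes "density n A"
  obtains l P where "ensemble n {..<n} l P A" "\<And>x. x < n \<Longrightarrow> vn_entropy (P x) = 0"
proof -
  obtain U l where U: "unitary n U" and l_nonneg: "\<And>i. i < n \<Longrightarrow> 0 \<le> l i"
    and l_sum: "(\<Sum>i<n. l i) = 1" and A: "A = unitary_diag n U l"
    using density_spectral[OF assms] by blast
  have "ensemble n {..<n} l (\<lambda>x. mat_unit n x x) (mat_diag n (\<lambda>i. of_real (l i)))"
    by (rule ensembleI)
      (use l_nonneg l_sum density_mat_unit in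
        \<open>auto simp: mat_unit_def mat_diag_def if_distrib cong: if_cong\<close>)
  from ensemble_unitary_conj[OF this U]
  have "ensemble n {..<n} l (\<lambda>x. U * mat_unit n x x * mat_adjoint U) A" by (simp add: A)
  moreover have "vn_entropy (U * mat_unit n x x * mat_adjoint U) = 0" for x
    unfolding mat_unit_diag vn_entropy_unitary_diag[OF U] by simp
  ultimately show ?thesis by (rule that)
qed

section \<open>Concavity of the entropy\<close>

lemma eta_tangent:
  assumes "0 < x" "0 \<le> y"
  shows "eta x + (ln x + 1) * (y - x) \<le> eta y"
proof (cases "y = 0")
  case True
  with assms show ?thesis by (simp add: eta_def algebra_simps)
next
  case False
  with assms have y_pos: "0 < y" by simp
  have "ln (x / y) \<le> x / y - 1"
    using assms y_pos by (intro ln_le_minus_one) auto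
  then have "y * ln (x / y) \<le> y * (x / y - 1)"
    using y_pos by (intro mult_left_mono) auto
  also have "\<dots> = x - y" using y_pos by (simp add: field_simps)
  finally show ?thesis
    using assms y_pos by (simp add: eta_def ln_div algebra_simps)
qed

lemma eta_jensen:
  fixes p x :: "'a \<Rightarrow> real"
  assumes "finite I" and p: "\<And>i. i \<in> I \<Longrightarrow> 0 \<le> p i" and x: "\<And>i. i \<in> I \<Longrightarrow> 0 \<le> x i"
    and p_sum: "(\<Sum>i\<in>I. p i) = 1"
  shows "eta (\<Sum>i\<in>I. p i * x i) \<le> (\<Sum>i\<in>I. p i * eta (x i))"
proof -
  define m where "m = (\<Sum>i\<in>I. p i * x i)"
  show ?thesis
  proof (cases "m = 0")
    case True
    then have "p i * x i = 0" if "i \<in> I" for i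
      using sum_nonneg_eq_0_iff[OF assms(1), of "\<lambda>i. p i * x i"] p x that by (simp add: m_def)
    then have "(\<Sum>i\<in>I. p i * eta (x i)) = 0" by (intro sum.neutral ballI) force
    with True show ?thesis by (simp add: m_def)
  next
    case False
    then have m_pos: "0 < m" using p x by (simp add: m_def sum_nonneg less_le)
    have "eta m = (\<Sum>i\<in>I. p i) * eta m + (ln m + 1) * (m - (\<Sum>i\<in>I. p i) * m)"
      by (simp add: p_sum)
    also have "\<dots> = (\<Sum>i\<in>I. p i * (eta m + (ln m + 1) * (x i - m)))"
      by (simp add: algebra_simps sum.distrib sum_subtractf sum_distrib_left sum_distrib_right)
        (simp add: mult.commute flip: m_def sum_distrib_left)
    also have "\<dots> \<le> (\<Sum>i\<in>I. p i * eta (x i))"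
      using p x by (intro sum_mono mult_left_mono eta_tangent m_pos) auto
    finally show ?thesis by (simp add: m_def)
  qed
qed

lemma unitary_row_norm:
  fixes U :: "complex mat"
  assumes "unitary n U" "a < n"
  shows "(\<Sum>b<n. (cmod (U $$ (a, b)))\<^sup>2) = 1"
proof -
  have "complex_of_real (\<Sum>b<n. (cmod (U $$ (a, b)))\<^sup>2) = (\<Sum>b<n. U $$ (a, b) * mat_adjoint U $$ (b, a))"
    using unitaryD(1)[OF assms(1)] assms(2) by (simp add: complex_norm_square del: of_real_power)
  also have "\<dots> = (U * mat_adjoint U) $$ (a, a)"
    using unitaryD(1)[OF assms(1)] assms(2) by (intro index_mult_mat_sum[symmetric]) auto
  finally show ?thesis
    using unitaryD(3)[OF assms(1)] assms(2)
    by (simp only: index_one_mat of_real_eq_1_iff simp_thms if_True)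
qed

lemma unitary_column_norm:
  fixes U :: "complex mat"
  assumes "unitary n U" "b < n"
  shows "(\<Sum>a<n. (cmod (U $$ (a, b)))\<^sup>2) = 1"
  using unitary_row_norm[OF unitary_mat_adjoint[OF assms(1)] assms(2)] unitaryD(1)[OF assms(1)] assms(2)
  by simp

lemma index_unitary_diag_diagonal:
  fixes U :: "complex mat"
  assumes "U \<in> carrier_mat n m" "i < n"
  shows "(unitary_diag m U l) $$ (i, i) =
    of_real (\<Sum>x<m. (cmod (U $$ (i, x)))\<^sup>2 * l x)"
  unfolding mat_diag_mult_right[OF assms(1)] of_real_sum of_real_mult complex_norm_square
  using assms by (subst index_mult_mat_sum[of _ n m _ n]) (auto intro!: sum.cong)

lemma vn_entropy_le_diagonal:
  assumes "psd n A"
  shows "vn_entropy A \<le> - (\<Sum>a<n. eta (Re (A $$ (a, a))))"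
proof -
  obtain U l where U: "unitary n U" and l_nonneg: "\<And>i. i < n \<Longrightarrow> 0 \<le> l i" and A: "A = unitary_diag n U l"
    using psd_spectral[OF assms] by blast
  let ?p = "\<lambda>a b. (cmod (U $$ (a, b)))\<^sup>2"
  have "(\<Sum>a<n. eta (Re (A $$ (a, a)))) = (\<Sum>a<n. eta (\<Sum>b<n. ?p a b * l b))"
    by (simp add: A index_unitary_diag_diagonal[OF unitaryD(1)[OF U]] del: of_real_sum)
  also have "\<dots> \<le> (\<Sum>a<n. \<Sum>b<n. ?p a b * eta (l b))"
    by (intro sum_mono eta_jensen) (use l_nonneg unitary_row_norm[OF U] in auto)
  also have "\<dots> = (\<Sum>b<n. (\<Sum>a<n. ?p a b) * eta (l b))"
    by (subst sum.swap) (simp add: sum_distrib_right)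
  also have "\<dots> = - vn_entropy A"
    by (simp add: unitary_column_norm[OF U] A vn_entropy_unitary_diag[OF U])
  finally show ?thesis by simp
qed

theorem vn_entropy_concave:
  assumes ens: "ensemble n I p T A"
  shows "(\<Sum>x\<in>I. p x * vn_entropy (T x)) \<le> vn_entropy A"
proof -
  obtain V l where V: "unitary n V" and A: "A = unitary_diag n V l"
    using psd_spectral[OF ensemble_psd[OF ens]] by blast
  define U where "U = mat_adjoint V"
  let ?T = "\<lambda>x. U * T x * mat_adjoint U"
  have U: "unitary n U" unfolding U_def by (rule unitary_mat_adjoint[OF V])
  have diag: "U * A * mat_adjoint U = mat_diag n (\<lambda>i. of_real (l i))"
    using unitary_conj_cancel[OF V mat_diag_dim] by (simp add: A U_def)
  note ens' = ensemble_unitary_conj[OF ens U, unfolded diag]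
  note T_density = densityD[OF ensembleD(3)[OF ens']]
  have l_eq: "l a = (\<Sum>x\<in>I. p x * Re (?T x $$ (a, a)))" if "a < n" for a
    using arg_cong[OF ensembleD(6)[OF ens' that that], of Re] that by (simp add: mat_diag_def)
  have "- vn_entropy A = (\<Sum>a<n. eta (\<Sum>x\<in>I. p x * Re (?T x $$ (a, a))))"
    by (simp add: A vn_entropy_unitary_diag[OF V] l_eq)
  also have "\<dots> \<le> (\<Sum>a<n. \<Sum>x\<in>I. p x * eta (Re (?T x $$ (a, a))))"
    by (intro sum_mono eta_jensen)
      (use ensembleD(1,2,4)[OF ens] psd_diag_nonneg[OF T_density(1)] in \<open>auto simp: less_eq_complex_def\<close>)
  also have "\<dots> = (\<Sum>x\<in>I. p x * (\<Sum>a<n. eta (Re (?T x $$ (a, a)))))"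
    by (subst sum.swap) (simp add: sum_distrib_left)
  also have "\<dots> \<le> (\<Sum>x\<in>I. p x * - vn_entropy (?T x))"
    using vn_entropy_le_diagonal[OF T_density(1)] ensembleD(2)[OF ens]
    by (intro sum_mono mult_left_mono) (auto simp: le_minus_iff)
  also have "\<dots> = - (\<Sum>x\<in>I. p x * vn_entropy (T x))"
    using vn_entropy_unitary_conj[OF U densityD(2)[OF ensembleD(3)[OF ens]]] by (simp add: sum_negf)
  finally show ?thesis by simp
qed

section \<open>Block matrices\<close>

lemma pair_index_less:
  fixes i d a k :: nat
  assumes "i < d" "a < k"
  shows "i * k + a < d * k"
proof -
  have "i * k + a < Suc i * k" using assms(2) by simp
  also have "\<dots> \<le> d * k" using assms(1) by (intro mult_le_mono1) simp
  finally show ?thesis .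
qed

lemma sum_pair_index:
  fixes f :: "nat \<Rightarrow> 'a::comm_monoid_add"
  shows "(\<Sum>r<d * k. f r) = (\<Sum>i<d. \<Sum>a<k. f (i * k + a))"
proof -
  have "(\<Sum>a<k. f (i * k + a)) = sum f {i * k..<i * k + k}" for i
    using sum.shift_bounds_nat_ivl[of f 0 "i * k" k] by (simp add: atLeast0LessThan add.commute)
  then show ?thesis by (simp add: sum.nat_group)
qed

lemma eq_mat_pairI:
  assumes "A \<in> carrier_mat (d * k) (d * k)" "B \<in> carrier_mat (d * k) (d * k)"
    and entry: "\<And>i j a b. i < d \<Longrightarrow> j < d \<Longrightarrow> a < k \<Longrightarrow> b < k \<Longrightarrow>
      A $$ (i * k + a, j * k + b) = B $$ (i * k + a, j * k + b)"
  shows "A = B"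
proof (rule eq_matI)
  fix r s assume "r < dim_row B" "s < dim_col B"
  then have rs: "r < d * k" "s < d * k" using assms(2) by auto
  then have "0 < k" by (cases k) auto
  then show "A $$ (r, s) = B $$ (r, s)"
    using entry[of "r div k" "s div k" "r mod k" "s mod k"] rs by (simp add: less_mult_imp_div_less)
qed (use assms in auto)

definition block :: "nat \<Rightarrow> 'a mat \<Rightarrow> nat \<Rightarrow> nat \<Rightarrow> 'a mat" where
  "block k X i j = mat k k (\<lambda>(a, b). X $$ (i * k + a, j * k + b))"

lemma block_carrier [simp]: "block k X i j \<in> carrier_mat k k"
  by (simp add: block_def)

lemma index_block [simp]: "a < k \<Longrightarrow> b < k \<Longrightarrow> block k X i j $$ (a, b) = X $$ (i * k + a, j * k + b)"
  by (simp add: block_def)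

lemma mtrace_eq_sum_blocks:
  assumes "X \<in> carrier_mat (d * k) (d * k)"
  shows "mtrace X = (\<Sum>i<d. mtrace (block k X i i))"
  using assms by (simp add: mtrace_def block_def sum_pair_index)

lemma psd_block:
  assumes "psd (d * k) X" "i < d"
  shows "psd k (block k X i i)"
  unfolding block_def
  by (rule psd_principal_submatrix[OF assms(1), of k "\<lambda>a. i * k + a"])
    (rule pair_index_less[OF assms(2)])

lemma ptrace_H_carrier [simp]: "ptrace_H d k X \<in> carrier_mat k k"
  by (simp add: ptrace_H_def)

lemma index_ptrace_H: "a < k \<Longrightarrow> b < k \<Longrightarrow> ptrace_H d k X $$ (a, b) = (\<Sum>i<d. block k X i i $$ (a, b))"
  by (simp add: ptrace_H_def)

lemma density_ptrace_H:
  assumes "density (d * k) X"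
  shows "density k (ptrace_H d k X)"
  unfolding density_def
proof
  show "psd k (ptrace_H d k X)"
    by (rule psd_nonneg_combination[where I = "{..<d}" and p = "\<lambda>_. 1" and G = "\<lambda>i. block k X i i"])
      (use psd_block[OF densityD(1)[OF assms]] in \<open>auto simp: ptrace_H_def\<close>)
  have "mtrace (ptrace_H d k X) = (\<Sum>i<d. \<Sum>a<k. X $$ (i * k + a, i * k + a))"
    by (subst sum.swap) (simp add: mtrace_def ptrace_H_def)
  then show "mtrace (ptrace_H d k X) = 1"
    using densityD(2,3)[OF assms] by (simp add: mtrace_def sum_pair_index)
qed

lemma density_ptrace_K:
  assumes "density (d * k) X"
  shows "density d (ptrace_K d k X)"
  unfolding density_def
proof
  let ?G = "\<lambda>a. mat d d (\<lambda>(i, j). X $$ (i * k + a, j * k + a))"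
  show "psd d (ptrace_K d k X)"
  proof (rule psd_nonneg_combination[where I = "{..<k}" and p = "\<lambda>_. 1" and G = ?G])
    show "psd d (?G a)" if "a \<in> {..<k}" for a
      by (rule psd_principal_submatrix[OF densityD(1)[OF assms], of d "\<lambda>i. i * k + a"])
        (use that in \<open>auto intro: pair_index_less\<close>)
  qed (auto simp: ptrace_K_def)
  show "mtrace (ptrace_K d k X) = 1"
    using densityD(2,3)[OF assms] by (simp add: mtrace_def ptrace_K_def sum_pair_index)
qed

lemma ensemble_ptrace_H:
  assumes ens: "ensemble (d * k) I p T A"
  shows "ensemble k I p (\<lambda>x. ptrace_H d k (T x)) (ptrace_H d k A)"
proof (rule ensembleI)
  show "ptrace_H d k A $$ (a, b) = (\<Sum>x\<in>I. of_real (p x) * ptrace_H d k (T x) $$ (a, b))"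
    if "a < k" "b < k" for a b
  proof -
    have "ptrace_H d k A $$ (a, b) = (\<Sum>i<d. \<Sum>x\<in>I. of_real (p x) * T x $$ (i * k + a, i * k + b))"
      using that by (simp add: index_ptrace_H ensembleD(6)[OF ens] pair_index_less)
    also have "\<dots> = (\<Sum>x\<in>I. of_real (p x) * ptrace_H d k (T x) $$ (a, b))"
      using that by (subst sum.swap) (simp add: index_ptrace_H sum_distrib_left)
    finally show ?thesis .
  qed
qed (use ensembleD[OF ens] density_ptrace_H in \<open>auto simp: ptrace_H_def\<close>)

lemma ensemble_diagonal_blocks:
  assumes X: "density (d * k) X"
  obtains q T where "ensemble k {..<d} q T (ptrace_H d k X)"
    "\<And>i. i < d \<Longrightarrow> block k X i i = of_real (q i) \<cdot>\<^sub>m T i"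
proof -
  define q where "q i = Re (mtrace (block k X i i))" for i
  note psd = psd_block[OF densityD(1)[OF X]]
  have "0 < k" using density_dim_pos[OF X] by simp
  then have "\<exists>T. density k T \<and> block k X i i = of_real (q i) \<cdot>\<^sub>m T" if "i < d" for i
    using psd_eq_smult_density[OF psd[OF that]] unfolding q_def by blast
  then obtain T where T: "\<And>i. i < d \<Longrightarrow> density k (T i)"
    and block_T: "\<And>i. i < d \<Longrightarrow> block k X i i = of_real (q i) \<cdot>\<^sub>m T i" by metis
  have "ensemble k {..<d} q T (ptrace_H d k X)"
  proof (rule ensembleI)
    show "(\<Sum>i<d. q i) = 1"
      using mtrace_eq_sum_blocks[OF densityD(2)[OF X]] densityD(3)[OF X]
      by (simp add: q_def flip: Re_sum)
    show "ptrace_H d k X $$ (a, b) = (\<Sum>i<d. of_real (q i) * T i $$ (a, b))" if "a < k" "b < k" for a b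
      unfolding index_ptrace_H[OF that]
      by (intro sum.cong refl)
        (use that carrier_matD[OF densityD(2)[OF T]] in \<open>auto simp: block_T simp del: index_block\<close>)
  qed (use T psd_mtrace(1)[OF psd] in \<open>auto simp: q_def ptrace_H_def\<close>)
  then show ?thesis using block_T by (rule that)
qed

definition block_row :: "nat \<Rightarrow> 'a mat \<Rightarrow> nat \<Rightarrow> 'a mat" where
  "block_row k W i = mat k (dim_col W) (\<lambda>(a, x). W $$ (i * k + a, x))"

lemma block_row_carrier [simp]: "W \<in> carrier_mat m n \<Longrightarrow> block_row k W i \<in> carrier_mat k n"
  by (auto simp: block_row_def)

lemma block_mult_adjoint:
  fixes W :: "complex mat"
  assumes W: "W \<in> carrier_mat (d * k) n" and i: "i < d"
  shows "block k (W * mat_adjoint W) i i = block_row k W i * mat_adjoint (block_row k W i)"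
proof (rule eq_matI)
  let ?R = "block_row k W i"
  fix a b assume "a < dim_row (?R * mat_adjoint ?R)" "b < dim_col (?R * mat_adjoint ?R)"
  then have ab: "a < k" "b < k" by (auto simp: block_row_def)
  note r = pair_index_less[OF i ab(1)] and s = pair_index_less[OF i ab(2)]
  have "block k (W * mat_adjoint W) i i $$ (a, b) = (W * mat_adjoint W) $$ (i * k + a, i * k + b)"
    by (rule index_block[OF ab])
  also have "\<dots> = (\<Sum>x<n. W $$ (i * k + a, x) * cnj (W $$ (i * k + b, x)))"
    using W s by (subst index_mult_mat_sum[OF W mat_adjoint_carrier[OF W] r s]) auto
  also have "\<dots> = (?R * mat_adjoint ?R) $$ (a, b)"
    using W ab
    by (subst index_mult_mat_sum[OF block_row_carrier[OF W]
          mat_adjoint_carrier[OF block_row_carrier[OF W]] ab]) (auto simp: block_row_def)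
  finally show "block k (W * mat_adjoint W) i i $$ (a, b) = (?R * mat_adjoint ?R) $$ (a, b)" .
qed (auto simp: block_row_def block_def)

lemma index_adjoint_mult_eq_sum_block_rows:
  fixes W :: "complex mat"
  assumes W: "W \<in> carrier_mat (d * k) n" and xy: "x < n" "y < n"
  shows "(mat_adjoint W * W) $$ (x, y) =
    (\<Sum>i<d. (mat_adjoint (block_row k W i) * block_row k W i) $$ (x, y))"
proof -
  have R: "block_row k W i \<in> carrier_mat k n" for i using W by simp
  have "(mat_adjoint W * W) $$ (x, y) = (\<Sum>i<d. \<Sum>a<k. cnj (W $$ (i * k + a, x)) * W $$ (i * k + a, y))"
    using W xy
    by (subst index_mult_mat_sum[OF mat_adjoint_carrier[OF W] W xy]) (simp add: sum_pair_index)
  also have "\<dots> = (\<Sum>i<d. (mat_adjoint (block_row k W i) * block_row k W i) $$ (x, y))"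
    by (intro sum.cong refl, subst index_mult_mat_sum[OF mat_adjoint_carrier[OF R] R xy])
      (use W xy in \<open>auto simp: block_row_def\<close>)
  finally show ?thesis .
qed

text \<open>The factor \<open>q\<close> in the last claim is needed: for \<open>q = 0\<close> the matrix \<open>P\<close> is arbitrary.\<close>

lemma adjoint_mult_eq_smult_density:
  assumes R: "R \<in> carrier_mat m n" and n: "0 < n" and q: "0 \<le> q" and T: "density m T"
    and outer_gram: "R * mat_adjoint R = of_real q \<cdot>\<^sub>m T"
  obtains P where "density n P" "mat_adjoint R * R = of_real q \<cdot>\<^sub>m P"
    "q * vn_entropy P = q * vn_entropy T"
proof -
  have trace: "mtrace (mat_adjoint R * R) = of_real q"
    using mtrace_mult_commute[OF mat_adjoint_carrier[OF R] R]
    by (simp add: outer_gram mtrace_smult[OF densityD(2)[OF T]] densityD(3)[OF T])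
  obtain P where P: "density n P" and inner_gram: "mat_adjoint R * R = of_real q \<cdot>\<^sub>m P"
    using psd_eq_smult_density[OF psd_adjoint_mult[OF R] n] by (auto simp: trace)
  have "vn_entropy (of_real q \<cdot>\<^sub>m P) = vn_entropy (of_real q \<cdot>\<^sub>m T)"
    using vn_entropy_mult_commute[OF R mat_adjoint_carrier[OF R]] by (simp add: outer_gram inner_gram)
  then have "q * vn_entropy P = q * vn_entropy T"
    by (simp add: vn_entropy_smult[OF densityD(1)[OF P] q] vn_entropy_smult[OF densityD(1)[OF T] q]
        densityD(3)[OF P] densityD(3)[OF T])
  with P inner_gram show ?thesis by (rule that)
qed

lemma vn_entropy_ge_diagonal_blocks:
  assumes B: "density (d * k) B" and q: "\<And>i. i < d \<Longrightarrow> 0 \<le> q i"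
    and T: "\<And>i. i < d \<Longrightarrow> density k (T i)"
    and block_T: "\<And>i. i < d \<Longrightarrow> block k B i i = of_real (q i) \<cdot>\<^sub>m T i"
  shows "(\<Sum>i<d. q i * vn_entropy (T i)) \<le> vn_entropy B"
proof -
  let ?n = "d * k"
  obtain W where W: "W \<in> carrier_mat ?n ?n" and B_eq: "B = W * mat_adjoint W"
    using psd_eq_mult_adjoint[OF densityD(1)[OF B]] by blast
  let ?R = "block_row k W"
  have "\<exists>P. density ?n P \<and> mat_adjoint (?R i) * ?R i = of_real (q i) \<cdot>\<^sub>m P \<and>
      q i * vn_entropy P = q i * vn_entropy (T i)" if i: "i < d" for i
  proof (rule adjoint_mult_eq_smult_density[OF block_row_carrier[OF W]
        density_dim_pos[OF B] q[OF i] T[OF i]])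
    show "?R i * mat_adjoint (?R i) = of_real (q i) \<cdot>\<^sub>m T i"
      using block_mult_adjoint[OF W i] block_T[OF i] by (simp add: B_eq)
  qed blast
  then obtain P where P: "\<And>i. i < d \<Longrightarrow> density ?n (P i)"
    and inner_gram: "\<And>i. i < d \<Longrightarrow> mat_adjoint (?R i) * ?R i = of_real (q i) \<cdot>\<^sub>m P i"
    and entropy_P: "\<And>i. i < d \<Longrightarrow> q i * vn_entropy (P i) = q i * vn_entropy (T i)" by metis
  have "ensemble ?n {..<d} q P (mat_adjoint W * W)"
  proof (rule ensembleI)
    have "of_real (\<Sum>i<d. q i) = (\<Sum>i<d. mtrace (block k B i i))"
      by (simp add: block_T mtrace_smult[OF densityD(2)[OF T]] densityD(3)[OF T])
    then show "(\<Sum>i<d. q i) = 1"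
      using mtrace_eq_sum_blocks[OF densityD(2)[OF B]] densityD(3)[OF B] by (simp only: of_real_eq_1_iff)
    show "(mat_adjoint W * W) $$ (x, y) = (\<Sum>i<d. of_real (q i) * P i $$ (x, y))"
      if "x < ?n" "y < ?n" for x y
      unfolding index_adjoint_mult_eq_sum_block_rows[OF W that]
      by (intro sum.cong refl) (use that carrier_matD[OF densityD(2)[OF P]] inner_gram in auto)
  qed (use q P W in \<open>auto intro: mult_carrier_mat\<close>)
  from vn_entropy_concave[OF this] have "(\<Sum>i<d. q i * vn_entropy (P i)) \<le> vn_entropy B"
    using vn_entropy_mult_commute[OF W mat_adjoint_carrier[OF W]] by (simp add: B_eq)
  then show ?thesis by (simp add: entropy_P)
qed

section \<open>Channels\<close>

lemma channelD:
  assumes "channel n m \<Psi>"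
  shows "A \<in> carrier_mat n n \<Longrightarrow> \<Psi> A \<in> carrier_mat m m"
    "A \<in> carrier_mat n n \<Longrightarrow> B \<in> carrier_mat n n \<Longrightarrow> \<Psi> (A + B) = \<Psi> A + \<Psi> B"
    "A \<in> carrier_mat n n \<Longrightarrow> \<Psi> (c \<cdot>\<^sub>m A) = c \<cdot>\<^sub>m \<Psi> A"
    "A \<in> carrier_mat n n \<Longrightarrow> mtrace (\<Psi> A) = mtrace A"
    "psd (p * n) X \<Longrightarrow> psd (p * m) (id_tensor p n m \<Psi> X)"
  using assms unfolding channel_def by blast+

lemma channel_linear_combination:
  assumes \<Psi>: "channel n m \<Psi>" and rs: "r < m" "s < m"
    and "finite I" "A \<in> carrier_mat n n" "\<And>x. x \<in> I \<Longrightarrow> M x \<in> carrier_mat n n"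
    and "\<And>i j. i < n \<Longrightarrow> j < n \<Longrightarrow> A $$ (i, j) = (\<Sum>x\<in>I. c x * M x $$ (i, j))"
  shows "\<Psi> A $$ (r, s) = (\<Sum>x\<in>I. c x * \<Psi> (M x) $$ (r, s))"
  using assms(4-)
proof (induction I arbitrary: A rule: finite_induct)
  case empty
  then have "A = 0 \<cdot>\<^sub>m A" by (intro eq_matI) auto
  then have "\<Psi> A = 0 \<cdot>\<^sub>m \<Psi> A" using channelD(3)[OF \<Psi> empty(1), of 0] by simp
  then show ?case using channelD(1)[OF \<Psi> empty(1)] rs
    by (metis carrier_matD index_smult_mat(1) mult_zero_left sum.empty)
next
  case (insert y I)
  define B where "B = mat n n (\<lambda>(i, j). \<Sum>x\<in>I. c x * M x $$ (i, j))"
  have B: "B \<in> carrier_mat n n" by (simp add: B_def)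
  have M: "M y \<in> carrier_mat n n" using insert.prems(2) by simp
  have "A = c y \<cdot>\<^sub>m M y + B"
    by (rule eq_matI) (use insert.hyps insert.prems carrier_matD[OF M] in \<open>auto simp: B_def\<close>)
  then have "\<Psi> A = c y \<cdot>\<^sub>m \<Psi> (M y) + \<Psi> B"
    by (simp add: channelD(2,3)[OF \<Psi>] M B)
  moreover have "\<Psi> B $$ (r, s) = (\<Sum>x\<in>I. c x * \<Psi> (M x) $$ (r, s))"
    by (rule insert.IH[OF B]) (use insert.prems(2) in \<open>auto simp: B_def\<close>)
  ultimately show ?case
    using insert.hyps rs channelD(1)[OF \<Psi> M] channelD(1)[OF \<Psi> B] by simp
qed

lemma channel_mat_unit_expansion:
  assumes \<Psi>: "channel n m \<Psi>" and A: "A \<in> carrier_mat n n" and rs: "r < m" "s < m"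
  shows "\<Psi> A $$ (r, s) = (\<Sum>a<n. \<Sum>b<n. A $$ (a, b) * \<Psi> (mat_unit n a b) $$ (r, s))"
proof -
  have "\<Psi> A $$ (r, s) = (\<Sum>x\<in>{..<n} \<times> {..<n}. A $$ x * \<Psi> (case x of (a, b) \<Rightarrow> mat_unit n a b) $$ (r, s))"
  proof (rule channel_linear_combination[OF \<Psi> rs _ A])
    show "A $$ (i, j) = (\<Sum>x\<in>{..<n} \<times> {..<n}. A $$ x * (case x of (a, b) \<Rightarrow> mat_unit n a b) $$ (i, j))"
      if "i < n" "j < n" for i j
    proof -
      have "(\<Sum>x\<in>{..<n} \<times> {..<n}. A $$ x * (case x of (a, b) \<Rightarrow> mat_unit n a b) $$ (i, j)) =
          (\<Sum>x\<in>{..<n} \<times> {..<n}. if x = (i, j) then A $$ x else 0)"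
        using that by (intro sum.cong refl) (auto simp: mat_unit_def split: if_splits)
      then show ?thesis using that by simp
    qed
  qed (auto simp: mat_unit_def)
  then show ?thesis by (simp add: sum.cartesian_product split_def)
qed

lemma channel_psd:
  assumes \<Psi>: "channel n m \<Psi>" and A: "psd n A"
  shows "psd m (\<Psi> A)"
proof -
  have "mat n n (\<lambda>(a, b). A $$ (a, b)) = A"
    by (rule eq_matI) (use psdD(1)[OF A] in auto)
  then have "id_tensor 1 n m \<Psi> A = \<Psi> A"
    by (intro eq_matI) (use channelD(1)[OF \<Psi> psdD(1)[OF A]] in \<open>auto simp: id_tensor_def\<close>)
  then show ?thesis using channelD(5)[OF \<Psi>, of 1 A] A by simp
qed

lemma channel_density: "channel n m \<Psi> \<Longrightarrow> density n A \<Longrightarrow> density m (\<Psi> A)"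
  using channel_psd channelD(4) densityD unfolding density_def by metis

lemma id_tensor_carrier [simp]: "id_tensor p n m \<Psi> X \<in> carrier_mat (p * m) (p * m)"
  by (simp add: id_tensor_def)

lemma block_id_tensor:
  assumes "channel n m \<Psi>" "i < p" "j < p"
  shows "block m (id_tensor p n m \<Psi> X) i j = \<Psi> (block n X i j)"
  using channelD(1)[OF assms(1) block_carrier[of n X i j]] assms
  by (intro eq_matI) (auto simp: block_def id_tensor_def pair_index_less)

lemma density_id_tensor:
  assumes \<Psi>: "channel n m \<Psi>" and X: "density (p * n) X"
  shows "density (p * m) (id_tensor p n m \<Psi> X)"
  unfolding density_def
proof
  have "mtrace (id_tensor p n m \<Psi> X) = (\<Sum>i<p. mtrace (\<Psi> (block n X i i)))"
    by (simp add: mtrace_eq_sum_blocks[of _ p m] block_id_tensor[OF \<Psi>])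
  also have "\<dots> = mtrace X"
    by (simp add: channelD(4)[OF \<Psi>] mtrace_eq_sum_blocks[OF densityD(2)[OF X]])
  finally show "mtrace (id_tensor p n m \<Psi> X) = 1" using densityD(3)[OF X] by simp
qed (rule channelD(5)[OF \<Psi> densityD(1)[OF X]])

lemma index_chan_tensor:
  assumes \<Omega>: "channel k m \<Omega>" and pq: "p < d'" "q < d'" and ab: "a < m" "b < m"
  shows "chan_tensor d d' k m \<Phi> \<Omega> X $$ (p * m + a, q * m + b) =
    (\<Sum>i<d. \<Sum>j<d. \<Phi> (mat_unit d i j) $$ (p, q) * \<Omega> (block k X i j) $$ (a, b))"
proof -
  have "chan_tensor d d' k m \<Phi> \<Omega> X $$ (p * m + a, q * m + b) =
      (\<Sum>i<d. \<Sum>j<d. \<Sum>x<k. \<Sum>y<k. X $$ (i * k + x, j * k + y) *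
        \<Phi> (mat_unit d i j) $$ (p, q) * \<Omega> (mat_unit k x y) $$ (a, b))"
    using pair_index_less[OF pq(1) ab(1)] pair_index_less[OF pq(2) ab(2)] ab
    by (simp add: chan_tensor_def)
  also have "\<dots> = (\<Sum>i<d. \<Sum>j<d. \<Phi> (mat_unit d i j) $$ (p, q) *
      (\<Sum>x<k. \<Sum>y<k. block k X i j $$ (x, y) * \<Omega> (mat_unit k x y) $$ (a, b)))"
    by (simp add: sum_distrib_left mult_ac)
  finally show ?thesis
    by (simp only: channel_mat_unit_expansion[OF \<Omega> block_carrier ab])
qed

section \<open>The convex closure of the output entropy\<close>

lemma H_chan_eq_Inf:
  assumes "A \<in> carrier_mat n n"
  shows "H_chan n \<Psi> A =
    Inf {\<Sum>j<N. p j * vn_entropy (\<Psi> (T j)) | (N::nat) p T. ensemble n {..<N} p T A}"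
  using assms by (simp add: H_chan_def ensemble_def Ball_def)

lemma H_chan_le:
  assumes nonneg: "\<And>T. density n T \<Longrightarrow> 0 \<le> vn_entropy (\<Psi> T)" and ens: "ensemble n I p T A"
  shows "H_chan n \<Psi> A \<le> (\<Sum>x\<in>I. p x * vn_entropy (\<Psi> (T x)))"
proof -
  obtain h where h: "bij_betw h {..<card I} I"
    using ex_bij_betw_nat_finite[OF ensembleD(1)[OF ens]] by (auto simp: atLeast0LessThan)
  have "(\<Sum>j<card I. (p \<circ> h) j * vn_entropy (\<Psi> ((T \<circ> h) j))) = (\<Sum>x\<in>I. p x * vn_entropy (\<Psi> (T x)))"
    using sum.reindex_bij_betw[OF h, of "\<lambda>x. p x * vn_entropy (\<Psi> (T x))"] by simp
  then show ?thesis
    unfolding H_chan_eq_Inf[OF ensembleD(5)[OF ens]]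
  proof (intro cInf_lower)
    show "bdd_below {\<Sum>j<N. p j * vn_entropy (\<Psi> (T j)) | (N::nat) p T. ensemble n {..<N} p T A}"
      by (rule bdd_belowI[of _ 0]) (auto intro!: sum_nonneg mult_nonneg_nonneg nonneg dest: ensembleD)
  qed (use ensemble_reindex[OF h ens] in force)
qed

lemma H_chan_greatest:
  assumes A: "density n A"
    and "\<And>(N::nat) p T. ensemble n {..<N} p T A \<Longrightarrow> c \<le> (\<Sum>j<N. p j * vn_entropy (\<Psi> (T j)))"
  shows "c \<le> H_chan n \<Psi> A"
  unfolding H_chan_eq_Inf[OF densityD(2)[OF A]]
proof (rule cInf_greatest)
  show "{\<Sum>j<N. p j * vn_entropy (\<Psi> (T j)) | (N::nat) p T. ensemble n {..<N} p T A} \<noteq> {}"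
    using ensemble_singleton[OF A, of "0::nat"] by (force simp flip: lessThan_Suc[of 0, simplified])
qed (use assms(2) in blast)

lemma H_chan_approx:
  assumes A: "density n A" and "0 < \<delta>"
  obtains N :: nat and p T where "ensemble n {..<N} p T A"
    "(\<Sum>j<N. p j * vn_entropy (\<Psi> (T j))) < H_chan n \<Psi> A + \<delta>"
proof -
  have "\<not> (\<forall>(N::nat) p T. ensemble n {..<N} p T A \<longrightarrow>
      H_chan n \<Psi> A + \<delta> \<le> (\<Sum>j<N. p j * vn_entropy (\<Psi> (T j))))"
    using H_chan_greatest[OF A, of "H_chan n \<Psi> A + \<delta>" \<Psi>] \<open>0 < \<delta>\<close> by force
  then show ?thesis using that by (auto simp: not_le)
qed

lemma H_chan_le_vn_entropy:
  assumes "\<And>T. density n T \<Longrightarrow> 0 \<le> vn_entropy (\<Psi> T)" "density n A"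
  shows "H_chan n \<Psi> A \<le> vn_entropy (\<Psi> A)"
  using H_chan_le[OF assms(1) ensemble_singleton[OF assms(2), of "()"]] by simp

theorem H_chan_convex:
  assumes nonneg: "\<And>T. density n T \<Longrightarrow> 0 \<le> vn_entropy (\<Psi> T)" and ens: "ensemble n I p T A"
  shows "H_chan n \<Psi> A \<le> (\<Sum>x\<in>I. p x * H_chan n \<Psi> (T x))"
proof (rule field_le_epsilon)
  \<comment> \<open>No minimal ensemble need exist for an arbitrary \<open>\<Psi>\<close>, so near-minimal ones are used.\<close>
  fix \<delta> :: real assume "0 < \<delta>"
  then have "\<exists>(N::nat) q R. ensemble n {..<N} q R (T x) \<and>
      (\<Sum>j<N. q j * vn_entropy (\<Psi> (R j))) < H_chan n \<Psi> (T x) + \<delta>" if "x \<in> I" for x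
    using H_chan_approx[OF ensembleD(3)[OF ens that]] by metis
  then obtain N :: "'a \<Rightarrow> nat" and q R where ens_T: "\<And>x. x \<in> I \<Longrightarrow> ensemble n {..<N x} (q x) (R x) (T x)"
    and less: "\<And>x. x \<in> I \<Longrightarrow> (\<Sum>j<N x. q x j * vn_entropy (\<Psi> (R x j))) < H_chan n \<Psi> (T x) + \<delta>"
    by metis
  have "H_chan n \<Psi> A \<le> (\<Sum>z\<in>(SIGMA x:I. {..<N x}).
      (case z of (x, j) \<Rightarrow> p x * q x j) * vn_entropy (\<Psi> (case z of (x, j) \<Rightarrow> R x j)))"
    by (rule H_chan_le[OF nonneg ensemble_refine[OF ens ens_T]])
  also have "\<dots> = (\<Sum>x\<in>I. p x * (\<Sum>j<N x. q x j * vn_entropy (\<Psi> (R x j))))"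
    using ensembleD(1)[OF ens] by (simp add: sum.Sigma sum_distrib_left mult.assoc split_def)
  also have "\<dots> \<le> (\<Sum>x\<in>I. p x * (H_chan n \<Psi> (T x) + \<delta>))"
    using less ensembleD(2)[OF ens] by (intro sum_mono mult_left_mono) (auto intro: less_imp_le)
  also have "\<dots> = (\<Sum>x\<in>I. p x * H_chan n \<Psi> (T x)) + \<delta>"
    using ensembleD(4)[OF ens] by (simp add: distrib_left sum.distrib flip: sum_distrib_right)
  finally show "H_chan n \<Psi> A \<le> (\<Sum>x\<in>I. p x * H_chan n \<Psi> (T x)) + \<delta>" .
qed

lemma vn_entropy_channel_nonneg: "channel n m \<Psi> \<Longrightarrow> density n T \<Longrightarrow> 0 \<le> vn_entropy (\<Psi> T)"
  using vn_entropy_density_nonneg channel_density by blast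

theorem H_chan_ptrace_H_le_id_tensor:
  assumes \<Omega>: "channel n m \<Omega>" and X: "density (d * n) X"
  shows "H_chan n \<Omega> (ptrace_H d n X) \<le> vn_entropy (id_tensor d n m \<Omega> X)"
proof -
  obtain q T where ens: "ensemble n {..<d} q T (ptrace_H d n X)"
    and block_T: "\<And>i. i < d \<Longrightarrow> block n X i i = of_real (q i) \<cdot>\<^sub>m T i"
    using ensemble_diagonal_blocks[OF X] by blast
  have "H_chan n \<Omega> (ptrace_H d n X) \<le> (\<Sum>i<d. q i * vn_entropy (\<Omega> (T i)))"
    by (rule H_chan_le[OF vn_entropy_channel_nonneg[OF \<Omega>] ens])
  also have "\<dots> \<le> vn_entropy (id_tensor d n m \<Omega> X)"
  proof (rule vn_entropy_ge_diagonal_blocks[OF density_id_tensor[OF \<Omega> X]])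
    show "block m (id_tensor d n m \<Omega> X) i i = of_real (q i) \<cdot>\<^sub>m \<Omega> (T i)" if "i < d" for i
      using that densityD(2)[OF ensembleD(3)[OF ens]]
      by (simp add: block_id_tensor[OF \<Omega>] block_T channelD(3)[OF \<Omega>])
  qed (use ensembleD(2,3)[OF ens] channel_density[OF \<Omega>] in auto)
  finally show ?thesis .
qed

section \<open>The erasure channel\<close>

definition binary_entropy :: "real \<Rightarrow> real" where
  "binary_entropy \<epsilon> = - eta \<epsilon> - eta (1 - \<epsilon>)"

lemma binary_entropy_nonneg: "0 \<le> \<epsilon> \<Longrightarrow> \<epsilon> \<le> 1 \<Longrightarrow> 0 \<le> binary_entropy \<epsilon>"
  using eta_nonpos[of \<epsilon>] eta_nonpos[of "1 - \<epsilon>"] by (simp add: binary_entropy_def)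

locale erasure_channel =
  fixes d :: nat and \<epsilon> :: real and \<omega> :: "complex vec"
  assumes \<omega>_orthogonal: "\<forall>i<d. \<omega> $ i = 0"
    and \<omega>_unit: "(\<Sum>i<Suc d. (cmod (\<omega> $ i))\<^sup>2) = 1"
    and \<epsilon>_nonneg: "0 \<le> \<epsilon>" and \<epsilon>_le_1: "\<epsilon> \<le> 1"
begin

lemma erasure_four_block:
  assumes "\<sigma> \<in> carrier_mat d d"
  shows "erasure d \<epsilon> \<omega> \<sigma> = four_block_mat (of_real (1 - \<epsilon>) \<cdot>\<^sub>m \<sigma>) (0\<^sub>m d 1) (0\<^sub>m 1 d)
    (of_real \<epsilon> \<cdot>\<^sub>m mat_diag 1 (\<lambda>_. mtrace \<sigma>))"
proof -
  have "(cmod (\<omega> $ d))\<^sup>2 = 1" using \<omega>_orthogonal \<omega>_unit by simp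
  then have "\<omega> $ d * cnj (\<omega> $ d) = 1" by (simp only: complex_norm_square[symmetric] of_real_1)
  with assms show ?thesis
    using \<omega>_orthogonal
    by (intro eq_matI) (auto simp: erasure_def mat_diag_def mult.assoc less_Suc_eq)
qed

lemma vn_entropy_erasure:
  assumes \<sigma>: "density d \<sigma>"
  shows "vn_entropy (erasure d \<epsilon> \<omega> \<sigma>) = binary_entropy \<epsilon> + (1 - \<epsilon>) * vn_entropy \<sigma>"
proof -
  note \<sigma>' = densityD[OF \<sigma>]
  have "of_real \<epsilon> \<cdot>\<^sub>m mat_diag 1 (\<lambda>_. mtrace \<sigma>) = mat_diag 1 (\<lambda>_. of_real \<epsilon>)"
    by (rule eq_matI) (auto simp: mat_diag_def \<sigma>'(3))
  then show ?thesis
    unfolding erasure_four_block[OF \<sigma>'(2)] binary_entropy_def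
    using vn_entropy_smult[OF \<sigma>'(1), of "1 - \<epsilon>"] \<epsilon>_le_1 \<sigma>'(2,3)
    by (subst vn_entropy_four_block_diag[of _ d _ 1]) (simp_all add: vn_entropy_mat_diag)
qed

lemma H_chan_erasure_le:
  assumes \<sigma>: "density d \<sigma>"
  shows "H_chan d (erasure d \<epsilon> \<omega>) \<sigma> \<le> binary_entropy \<epsilon>"
proof -
  obtain l P where ens: "ensemble d {..<d} l P \<sigma>" and pure: "\<And>x. x < d \<Longrightarrow> vn_entropy (P x) = 0"
    using density_pure_ensemble[OF \<sigma>] by blast
  have "H_chan d (erasure d \<epsilon> \<omega>) \<sigma> \<le> (\<Sum>x<d. l x * vn_entropy (erasure d \<epsilon> \<omega> (P x)))"
  proof (rule H_chan_le[OF _ ens])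
    show "0 \<le> vn_entropy (erasure d \<epsilon> \<omega> T)" if "density d T" for T
      using vn_entropy_density_nonneg[OF that] binary_entropy_nonneg \<epsilon>_nonneg \<epsilon>_le_1
      by (simp add: vn_entropy_erasure[OF that])
  qed
  also have "\<dots> = (\<Sum>x<d. l x) * binary_entropy \<epsilon>"
    using ensembleD(3)[OF ens] by (simp add: vn_entropy_erasure pure sum_distrib_right)
  finally show ?thesis using ensembleD(4)[OF ens] by simp
qed

lemma index_erasure_mat_unit:
  assumes "i < d" "j < d" "p < Suc d" "q < Suc d"
  shows "erasure d \<epsilon> \<omega> (mat_unit d i j) $$ (p, q) =
    (if p < d \<and> q < d then (if i = p \<and> j = q then of_real (1 - \<epsilon>) else 0)
     else if p = d \<and> q = d then (if i = j then of_real \<epsilon> else 0) else 0)"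
proof -
  have "mtrace (mat_unit d i j) = (if i = j then 1 else 0)"
    using assms(1,2) by (auto simp: mtrace_def mat_unit_def if_distrib if_distribR cong: if_cong)
  moreover have "mat_unit d i j \<in> carrier_mat d d" by (simp add: mat_unit_def)
  ultimately show ?thesis
    using assms by (auto simp: erasure_four_block mat_unit_def mat_diag_def)
qed

lemma index_chan_tensor_erasure:
  assumes \<Omega>: "channel k m \<Omega>" and pq: "p < Suc d" "q < Suc d" and ab: "a < m" "b < m"
  shows "chan_tensor d (Suc d) k m (erasure d \<epsilon> \<omega>) \<Omega> X $$ (p * m + a, q * m + b) =
    (if p < d \<and> q < d then of_real (1 - \<epsilon>) * \<Omega> (block k X p q) $$ (a, b)
     else if p = d \<and> q = d then of_real \<epsilon> * \<Omega> (ptrace_H d k X) $$ (a, b) else 0)"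
    (is "?L = _")
proof -
  let ?\<Omega> = "\<lambda>i j. \<Omega> (block k X i j) $$ (a, b)"
  note entry = index_chan_tensor[OF \<Omega> pq ab, of d "erasure d \<epsilon> \<omega>" X]
  consider (kept) "p < d" "q < d" | (erased) "p = d" "q = d" | (off) "p < d \<longleftrightarrow> q = d" "p = d \<longleftrightarrow> q < d"
    using pq by linarith
  then show ?thesis
  proof cases
    case kept
    have "?L = (\<Sum>i<d. \<Sum>j<d. if j = q then if i = p then of_real (1 - \<epsilon>) * ?\<Omega> i j else 0 else 0)"
      unfolding entry by (intro sum.cong refl) (use kept in \<open>auto simp: index_erasure_mat_unit\<close>)
    then show ?thesis using kept by simp
  next
    case erased
    have "?L = (\<Sum>i<d. \<Sum>j<d. if j = i then of_real \<epsilon> * ?\<Omega> i j else 0)"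
      unfolding entry by (intro sum.cong refl) (use erased in \<open>auto simp: index_erasure_mat_unit\<close>)
    also have "\<dots> = of_real \<epsilon> * (\<Sum>i<d. ?\<Omega> i i)"
      by (simp add: sum_distrib_left)
    also have "(\<Sum>i<d. ?\<Omega> i i) = \<Omega> (ptrace_H d k X) $$ (a, b)"
      using channel_linear_combination[OF \<Omega> ab finite_lessThan[of d] ptrace_H_carrier[of d k X],
          of "\<lambda>i. block k X i i" "\<lambda>_. 1"]
      by (simp add: index_ptrace_H)
    finally show ?thesis using erased by simp
  next
    case off
    then show ?thesis
      unfolding entry using pq by (auto simp: index_erasure_mat_unit)
  qed
qed

lemma chan_tensor_erasure_four_block:
  assumes \<Omega>: "channel k m \<Omega>"
  shows "chan_tensor d (Suc d) k m (erasure d \<epsilon> \<omega>) \<Omega> X =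
    four_block_mat (of_real (1 - \<epsilon>) \<cdot>\<^sub>m id_tensor d k m \<Omega> X) (0\<^sub>m (d * m) m) (0\<^sub>m m (d * m))
      (of_real \<epsilon> \<cdot>\<^sub>m \<Omega> (ptrace_H d k X))" (is "?L = ?R")
proof (rule eq_mat_pairI[where d = "Suc d" and k = m])
  note H = channelD(1)[OF \<Omega> ptrace_H_carrier[of d k X]]
  note [simp] = carrier_matD[OF H] carrier_matD[OF id_tensor_carrier[of d k m \<Omega> X]]
  show "?L \<in> carrier_mat (Suc d * m) (Suc d * m)" by (simp add: chan_tensor_def)
  show "?R \<in> carrier_mat (Suc d * m) (Suc d * m)"
    using four_block_carrier_mat[OF smult_carrier_mat[OF id_tensor_carrier] smult_carrier_mat[OF H]]
    by (simp add: add.commute)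
  fix p q a b assume pq: "p < Suc d" "q < Suc d" and ab: "a < m" "b < m"
  have "id_tensor d k m \<Omega> X $$ (p * m + a, q * m + b) = \<Omega> (block k X p q) $$ (a, b)" if "p < d" "q < d"
    using index_block[OF ab, of "id_tensor d k m \<Omega> X" p q] block_id_tensor[OF \<Omega> that] by simp
  moreover have "x * m + c < d * m \<longleftrightarrow> x < d" if "x < Suc d" "c < m" for x c
    using pair_index_less[of x d c m] that by (cases "x = d") auto
  ultimately show "?L $$ (p * m + a, q * m + b) = ?R $$ (p * m + a, q * m + b)"
    using pq ab pair_index_less[OF pq(1) ab(1)] pair_index_less[OF pq(2) ab(2)]
    by (auto simp: index_chan_tensor_erasure[OF \<Omega> pq ab] less_Suc_eq)
qed

lemma vn_entropy_chan_tensor_erasure: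
  assumes \<Omega>: "channel k m \<Omega>" and X: "density (d * k) X"
  shows "vn_entropy (chan_tensor d (Suc d) k m (erasure d \<epsilon> \<omega>) \<Omega> X) =
    binary_entropy \<epsilon> + \<epsilon> * vn_entropy (\<Omega> (ptrace_H d k X)) + (1 - \<epsilon>) * vn_entropy (id_tensor d k m \<Omega> X)"
proof -
  note T = densityD[OF density_id_tensor[OF \<Omega> X]]
  note H = densityD[OF channel_density[OF \<Omega> density_ptrace_H[OF X]]]
  show ?thesis
    unfolding chan_tensor_erasure_four_block[OF \<Omega>] binary_entropy_def
    using vn_entropy_smult[OF T(1), of "1 - \<epsilon>"] vn_entropy_smult[OF H(1), of \<epsilon>] \<epsilon>_nonneg \<epsilon>_le_1 T H
    by (subst vn_entropy_four_block_diag[of _ "d * m" _ m]) simp_all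
qed

lemma H_chan_ptrace_H_le_chan_tensor_erasure:
  assumes \<Omega>: "channel k m \<Omega>" and X: "density (d * k) X"
  shows "binary_entropy \<epsilon> + H_chan k \<Omega> (ptrace_H d k X) \<le>
    vn_entropy (chan_tensor d (Suc d) k m (erasure d \<epsilon> \<omega>) \<Omega> X)"
proof -
  let ?H = "H_chan k \<Omega> (ptrace_H d k X)"
  have "?H = \<epsilon> * ?H + (1 - \<epsilon>) * ?H" by (simp add: algebra_simps)
  also have "\<dots> \<le> \<epsilon> * vn_entropy (\<Omega> (ptrace_H d k X)) + (1 - \<epsilon>) * vn_entropy (id_tensor d k m \<Omega> X)"
    using H_chan_le_vn_entropy[OF vn_entropy_channel_nonneg[OF \<Omega>] density_ptrace_H[OF X]]
      H_chan_ptrace_H_le_id_tensor[OF \<Omega> X] \<epsilon>_nonneg \<epsilon>_le_1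
    by (intro add_mono mult_left_mono) auto
  finally show ?thesis by (simp add: vn_entropy_chan_tensor_erasure[OF \<Omega> X])
qed

end

theorem theorem6:
  fixes d k :: nat and \<epsilon> :: real and \<omega> :: "complex vec"
    and \<Omega> :: "complex mat \<Rightarrow> complex mat" and \<rho> :: "complex mat"
  assumes "\<omega> \<in> carrier_vec (Suc d)"
    and "\<forall>i<d. \<omega> $ i = 0"
    and "(\<Sum>i<Suc d. (cmod (\<omega> $ i))\<^sup>2) = 1"
    and "0 \<le> \<epsilon>" and "\<epsilon> \<le> 1"
    and "channel k k \<Omega>"
    and "density (d * k) \<rho>"
  shows "H_chan (d * k) (chan_tensor d (Suc d) k k (erasure d \<epsilon> \<omega>) \<Omega>) \<rho>
         \<ge> H_chan d (erasure d \<epsilon> \<omega>) (ptrace_K d k \<rho>) + H_chan k \<Omega> (ptrace_H d k \<rho>)"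
proof -
  interpret erasure_channel d \<epsilon> \<omega> by unfold_locales (fact assms)+
  let ?\<Psi> = "chan_tensor d (Suc d) k k (erasure d \<epsilon> \<omega>) \<Omega>" and ?H = "\<lambda>\<sigma>. H_chan k \<Omega> (ptrace_H d k \<sigma>)"
  have "binary_entropy \<epsilon> + ?H \<rho> \<le> H_chan (d * k) ?\<Psi> \<rho>"
  proof (rule H_chan_greatest[OF \<open>density (d * k) \<rho>\<close>])
    fix N :: nat and \<pi> \<sigma> assume ens: "ensemble (d * k) {..<N} \<pi> \<sigma> \<rho>"
    have "binary_entropy \<epsilon> + ?H \<rho> \<le> binary_entropy \<epsilon> + (\<Sum>j<N. \<pi> j * ?H (\<sigma> j))"
      using H_chan_convex[OF vn_entropy_channel_nonneg[OF \<open>channel k k \<Omega>\<close>] ensemble_ptrace_H[OF ens]]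
      by simp
    also have "\<dots> = (\<Sum>j<N. \<pi> j * (binary_entropy \<epsilon> + ?H (\<sigma> j)))"
      using ensembleD(4)[OF ens] by (simp add: distrib_left sum.distrib flip: sum_distrib_right)
    also have "\<dots> \<le> (\<Sum>j<N. \<pi> j * vn_entropy (?\<Psi> (\<sigma> j)))"
      using ensembleD(2,3)[OF ens] H_chan_ptrace_H_le_chan_tensor_erasure[OF \<open>channel k k \<Omega>\<close>]
      by (intro sum_mono mult_left_mono) auto
    finally show "binary_entropy \<epsilon> + ?H \<rho> \<le> (\<Sum>j<N. \<pi> j * vn_entropy (?\<Psi> (\<sigma> j)))" .
  qed
  moreover have "H_chan d (erasure d \<epsilon> \<omega>) (ptrace_K d k \<rho>) \<le> binary_entropy \<epsilon>"
    by (rule H_chan_erasure_le[OF density_ptrace_K[OF \<open>density (d * k) \<rho>\<close>]])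
  ultimately show ?thesis by linarith
qed

end
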